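(* Let $S$ be an idempotent semifield, let $V$ be a free $S$-module of finite rank $n$ with basis $e_1,\dots,e_n$, let $w\in\bigwedge^dV$ be a tropical Plücker vector of rank $d$, and let $L_w\subset V$ be the associated rank $d$ tropical linear space, with associated quotient module $Q_w$. Then the linear dual of the quotient map $\bigwedge^dV^\vee\twoheadrightarrow\bigwedge^dQ_w$ identifies $\left(\bigwedge^dQ_w\right)^\vee$ with the tropical Plücker vector $w\in\mathbb{P}\left(\bigwedge^dV\right)$; that is, the image of the dual map $\left(\bigwedge^dQ_w\right)^\vee\to\left(\bigwedge^dV^\vee\right)^\vee\cong\bigwedge^dV$ is the rank one free submodule $S\cdot w$.
   Context: An idempotent semifield $S$ is a (commutative) semiring satisfying all axioms of a field except the existence of additive inverses, and such that $s+s=s$ for all $s\in S$; its additive and multiplicative identities are $0$ and $1$. For an $S$-module $M$, $M^\vee=\mathrm{Hom}_S(M,S)$. Write $[n]=\{1,\dots,n\}$, $I+j=I\cup\{j\}$, $I-j=I\smallsetminus\{j\}$, and let $x_1,\dots,x_n\in V^\vee$ be the basis dual to $e_1,\dots,e_n$. A congruence on an $S$-module (or $S$-algebra) $M$ is an equivalence relation on $M$ which is a submodule (subalgebra) of $M\times M$. Tropical Grassmann algebra. $\bigwedge V:=\mathrm{Sym}\,V/\langle e_i^2\sim 0\rangle_{i=1}^n$ (quotient by the generated $S$-algebra congruence), graded by $\bigwedge V=\bigoplus_{d\ge 0}\bigwedge^d V$, with (commutative) product denoted $\wedge$. $\bigwedge^dV$ is free with basis $e_I=e_{i_1}\wedge\cdots\wedge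 e_{i_d}$, $I=\{i_1,\dots,i_d\}\in\binom{[n]}{d}$. Similarly $\bigwedge^dV^\vee$ is free with basis $x_I$; there is a canonical isomorphism $(\bigwedge^dV^\vee)^\vee\cong\bigwedge^dV$ under which $\{e_I\}$ is the basis dual to $\{x_I\}$. If $F\twoheadrightarrow M$ is a surjection from a finite rank free module $F$ with basis $f_1,\dots,f_n$, the tropical Grassmann algebra of $M$ relative to this presentation is $\bigwedge M:=\bigwedge F\otimes_{\mathrm{Sym}\,F}\mathrm{Sym}\,M$, i.e. the quotient of $\mathrm{Sym}\,M$ by the algebra congruence setting the squares of the images of the $f_i$ to $0$; it is graded, with degree $d$ part $\bigwedge^d M$. $\mathbb{P}(\bigwedge^dV)$ is the set of nonzero elements of $\bigwedge^dV$ modulo multiplication by nonzero scalars of $S$. Tropical Plücker vectors. A nonzero $w=\sum_I w_Ie_I\in\bigwedge^dV$ is a rank $d$ tropical Plücker vector if for all $A\in\binom{[n]}{d+1}$, $B\in\binom{[n]}{d-1}$ and every $p\in A\smallsetminus B$, $\sum_{i\in A\smallsetminus B}w_{A-i}w_{B+i}=\sum_{i\in A\smallsetminus B,\, i\ne p}w_{A-i}w_{B+i}$. Bend relations, $Q_w$ and $L_w$. The bend relations of a linear form $f=\sum_i f_ix_i\in V^\vee$ are the relations $f\sim\sum_{i\neq j}f_ix_i$ for $j=1,\dots,n$. For a linear map $\varphi:V\to M$, $\mathcal{B}(\varphi)$ is the $S$-module congruence on $V^\vee$ generated by the bend relations of all $f$ in the image of the dual map $\varphi^\vee:M^\vee\to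 V^\vee$. Set $Q_w:=V^\vee/\mathcal{B}(-\wedge w)$, where $-\wedge w:V\to\bigwedge^{d+1}V$, and $L_w:=Q_w^\vee\subset V^{\vee\vee}\cong V$. The algebra $\bigwedge Q_w$ is taken relative to the presentation $V^\vee\twoheadrightarrow Q_w$ and the basis $x_1,\dots,x_n$. *)

theory Defs
  imports "HOL-Algebra.Module" "HOL-Library.FuncSet" "HOL-Library.Multiset"
    "HOL-Library.Poly_Mapping"
begin

section \<open>Idempotent semifields and their modules\<close>

class idempotent_semifield = comm_semiring_1 +
  assumes add_idempotent: "a + a = a"
    and ex_mult_inverse: "a \<noteq> 0 \<Longrightarrow> \<exists>b. a * b = 1"

text \<open>
  The scalars form a type, while modules and algebras are objects with carriers; they are
  represented by the HOL-Algebra record \<^typ>\<open>('s, 'm) module\<close>. The locale \<open>module\<close> of HOL-Algebra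
  asks for additive inverses, so semimodules need their own locale. As there, the
  multiplicative fields of the record are irrelevant for objects that are only modules.
\<close>

locale semimodule = abelian_monoid M
  for M :: "('s::idempotent_semifield, 'm) module" (structure) +
  assumes smult_closed: "x \<in> carrier M \<Longrightarrow> a \<odot> x \<in> carrier M"
    and smult_l_distr: "x \<in> carrier M \<Longrightarrow> (a + b) \<odot> x = a \<odot> x \<oplus> b \<odot> x"
    and smult_r_distr: "x \<in> carrier M \<Longrightarrow> y \<in> carrier M \<Longrightarrow> a \<odot> (x \<oplus> y) = a \<odot> x \<oplus> a \<odot> y"
    and smult_assoc: "x \<in> carrier M \<Longrightarrow> (a * b) \<odot> x = a \<odot> (b \<odot> x)"
    and smult_one: "x \<in> carrier M \<Longrightarrow> 1 \<odot> x = x"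
    and smult_l_null: "x \<in> carrier M \<Longrightarrow> 0 \<odot> x = \<zero>"
    and smult_r_null: "a \<odot> \<zero> = \<zero>"

definition is_basis :: "('s::idempotent_semifield, 'm) module \<Rightarrow> 'i set \<Rightarrow> ('i \<Rightarrow> 'm) \<Rightarrow> bool" where
  "is_basis M I e \<longleftrightarrow> finite I \<and> e \<in> I \<rightarrow> carrier M \<and>
     (\<forall>x\<in>carrier M. \<exists>!c. c \<in> extensional I \<and> x = (\<Oplus>\<^bsub>M\<^esub>i\<in>I. c i \<odot>\<^bsub>M\<^esub> e i))"

definition basis_coord :: "('s::idempotent_semifield, 'm) module \<Rightarrow> 'i set \<Rightarrow> ('i \<Rightarrow> 'm) \<Rightarrow> 'm \<Rightarrow> 'i \<Rightarrow> 's" where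
  "basis_coord M I e x =
     (THE c. c \<in> extensional I \<and> x = (\<Oplus>\<^bsub>M\<^esub>i\<in>I. c i \<odot>\<^bsub>M\<^esub> e i))"

definition dual :: "('s::idempotent_semifield, 'm) module \<Rightarrow> ('s, 'm \<Rightarrow> 's) module" where
  "dual M =
     \<lparr>carrier = {f \<in> extensional (carrier M).
        (\<forall>x\<in>carrier M. \<forall>y\<in>carrier M. f (x \<oplus>\<^bsub>M\<^esub> y) = f x + f y) \<and>
        (\<forall>a. \<forall>x\<in>carrier M. f (a \<odot>\<^bsub>M\<^esub> x) = a * f x)},
      monoid.mult = undefined, one = undefined,
      zero = (\<lambda>x\<in>carrier M. 0),
      add = (\<lambda>f g. \<lambda>x\<in>carrier M. f x + g x),
      smult = (\<lambda>a f. \<lambda>x\<in>carrier M. a * f x)\<rparr>"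

text \<open>The dual of a linear map \<open>\<phi>\<close> with domain \<open>M\<close>: precomposition with \<open>\<phi>\<close>.\<close>

definition dual_map :: "('s::idempotent_semifield, 'm) module \<Rightarrow> ('m \<Rightarrow> 'n) \<Rightarrow> ('n \<Rightarrow> 's) \<Rightarrow> 'm \<Rightarrow> 's" where
  "dual_map M \<phi> \<psi> = (\<lambda>x\<in>carrier M. \<psi> (\<phi> x))"

definition dual_basis :: "('s::idempotent_semifield, 'm) module \<Rightarrow> 'i set \<Rightarrow> ('i \<Rightarrow> 'm) \<Rightarrow> 'i \<Rightarrow> 'm \<Rightarrow> 's" where
  "dual_basis M I e i =
     (THE f. f \<in> carrier (dual M) \<and> (\<forall>j\<in>I. f (e j) = (if j = i then 1 else 0)))"


section \<open>Congruences and quotients\<close>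

definition module_congruence :: "('s::idempotent_semifield, 'm) module \<Rightarrow> ('m \<times> 'm) set \<Rightarrow> bool" where
  "module_congruence M r \<longleftrightarrow> equiv (carrier M) r \<and>
     (\<forall>x x' y y'. (x, x') \<in> r \<and> (y, y') \<in> r \<longrightarrow> (x \<oplus>\<^bsub>M\<^esub> y, x' \<oplus>\<^bsub>M\<^esub> y') \<in> r) \<and>
     (\<forall>a x x'. (x, x') \<in> r \<longrightarrow> (a \<odot>\<^bsub>M\<^esub> x, a \<odot>\<^bsub>M\<^esub> x') \<in> r)"

definition algebra_congruence :: "('s::idempotent_semifield, 'm) module \<Rightarrow> ('m \<times> 'm) set \<Rightarrow> bool" where
  "algebra_congruence A r \<longleftrightarrow> module_congruence A r \<and>
     (\<forall>x x' y y'. (x, x') \<in> r \<and> (y, y') \<in> r \<longrightarrow> (x \<otimes>\<^bsub>A\<^esub> y, x' \<otimes>\<^bsub>A\<^esub> y') \<in> r)"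

definition module_cong_gen :: "('s::idempotent_semifield, 'm) module \<Rightarrow> ('m \<times> 'm) set \<Rightarrow> ('m \<times> 'm) set" where
  "module_cong_gen M R = \<Inter>{r. module_congruence M r \<and> R \<subseteq> r}"

definition algebra_cong_gen :: "('s::idempotent_semifield, 'm) module \<Rightarrow> ('m \<times> 'm) set \<Rightarrow> ('m \<times> 'm) set" where
  "algebra_cong_gen A R = \<Inter>{r. algebra_congruence A r \<and> R \<subseteq> r}"

text \<open>
  The multiplicative fields are meaningful only if \<open>M\<close> is an algebra and \<open>r\<close> is an
  algebra congruence.
\<close>

definition quot :: "('s::idempotent_semifield, 'm) module \<Rightarrow> ('m \<times> 'm) set \<Rightarrow> ('s, 'm set) module" where
  "quot M r =
     \<lparr>carrier = carrier M // r,
      monoid.mult = (\<lambda>X Y. \<Union>x\<in>X. \<Union>y\<in>Y. r `` {x \<otimes>\<^bsub>M\<^esub> y}),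
      one = r `` {\<one>\<^bsub>M\<^esub>},
      zero = r `` {\<zero>\<^bsub>M\<^esub>},
      add = (\<lambda>X Y. \<Union>x\<in>X. \<Union>y\<in>Y. r `` {x \<oplus>\<^bsub>M\<^esub> y}),
      smult = (\<lambda>a X. \<Union>x\<in>X. r `` {a \<odot>\<^bsub>M\<^esub> x})\<rparr>"

text \<open>The map induced by \<open>f\<close> from some quotient to the quotient by \<open>r\<close>.\<close>

definition quot_map :: "('n \<times> 'n) set \<Rightarrow> ('m \<Rightarrow> 'n) \<Rightarrow> 'm set \<Rightarrow> 'n set" where
  "quot_map r f X = (\<Union>x\<in>X. r `` {f x})"


section \<open>Symmetric algebras\<close>

text \<open>
  The free commutative algebra on a set \<open>X\<close> is the algebra of polynomials with the elements of
  \<open>X\<close> as variables, a monomial being a multiset over \<open>X\<close>. The symmetric algebra of \<open>M\<close> is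
  the quotient of the free commutative algebra on the set \<open>carrier M\<close> which makes the
  inclusion of \<open>M\<close> linear.
\<close>

definition free_comm_algebra :: "'m set \<Rightarrow> ('s::idempotent_semifield, 'm multiset \<Rightarrow>\<^sub>0 's) module" where
  "free_comm_algebra X =
     \<lparr>carrier = {p. \<forall>m\<in>Poly_Mapping.keys p. set_mset m \<subseteq> X},
      monoid.mult = (*), one = 1, zero = 0, add = (+),
      smult = (\<lambda>a p. Poly_Mapping.single {#} a * p)\<rparr>"

definition free_var :: "'m \<Rightarrow> 'm multiset \<Rightarrow>\<^sub>0 's::idempotent_semifield" where
  "free_var x = Poly_Mapping.single {#x#} 1"

definition sym_rel :: "('s::idempotent_semifield, 'm) module \<Rightarrow>
    (('m multiset \<Rightarrow>\<^sub>0 's) \<times> ('m multiset \<Rightarrow>\<^sub>0 's)) set" where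
  "sym_rel M =
     {(free_var (x \<oplus>\<^bsub>M\<^esub> y), free_var x + free_var y) | x y. x \<in> carrier M \<and> y \<in> carrier M} \<union>
     {(free_var (a \<odot>\<^bsub>M\<^esub> x), Poly_Mapping.single {#} a * free_var x) | a x. x \<in> carrier M}"

definition sym_cong :: "('s::idempotent_semifield, 'm) module \<Rightarrow>
    (('m multiset \<Rightarrow>\<^sub>0 's) \<times> ('m multiset \<Rightarrow>\<^sub>0 's)) set" where
  "sym_cong M = algebra_cong_gen (free_comm_algebra (carrier M)) (sym_rel M)"

definition Sym :: "('s::idempotent_semifield, 'm) module \<Rightarrow> ('s, ('m multiset \<Rightarrow>\<^sub>0 's) set) module" where
  "Sym M = quot (free_comm_algebra (carrier M)) (sym_cong M)"

definition sym_incl :: "('s::idempotent_semifield, 'm) module \<Rightarrow> 'm \<Rightarrow> ('m multiset \<Rightarrow>\<^sub>0 's) set" where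
  "sym_incl M x = sym_cong M `` {free_var x}"

definition sym_deg :: "('s::idempotent_semifield, 'm) module \<Rightarrow> nat \<Rightarrow> ('m multiset \<Rightarrow>\<^sub>0 's) set set" where
  "sym_deg M d = {sym_cong M `` {p} | p.
     p \<in> carrier (free_comm_algebra (carrier M)) \<and> (\<forall>m\<in>Poly_Mapping.keys p. size m = d)}"

text \<open>Functoriality: \<open>free_map f\<close> substitutes \<open>f x\<close> for each variable \<open>x\<close>.\<close>

definition free_map :: "('m \<Rightarrow> 'n) \<Rightarrow> ('m multiset \<Rightarrow>\<^sub>0 's) \<Rightarrow> ('n multiset \<Rightarrow>\<^sub>0 's::idempotent_semifield)" where
  "free_map f p =
     (\<Sum>m\<in>Poly_Mapping.keys p. Poly_Mapping.single (image_mset f m) (Poly_Mapping.lookup p m))"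

definition sym_map :: "('s::idempotent_semifield, 'n) module \<Rightarrow> ('m \<Rightarrow> 'n) \<Rightarrow>
    ('m multiset \<Rightarrow>\<^sub>0 's) set \<Rightarrow> ('n multiset \<Rightarrow>\<^sub>0 's) set" where
  "sym_map N f = quot_map (sym_cong N) (free_map f)"


section \<open>Tropical Grassmann algebras\<close>

text \<open>
  A presentation \<open>F \<twoheadrightarrow> M\<close> of \<open>M\<close> by a free module with a finite basis enters the
  definition only through the family \<open>b\<close>, indexed by \<open>I\<close>, of the images in \<open>M\<close> of the
  basis elements.
\<close>

definition ext_cong :: "('s::idempotent_semifield, 'm) module \<Rightarrow> 'i set \<Rightarrow> ('i \<Rightarrow> 'm) \<Rightarrow>
    (('m multiset \<Rightarrow>\<^sub>0 's) set \<times> ('m multiset \<Rightarrow>\<^sub>0 's) set) set" where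
  "ext_cong M I b = algebra_cong_gen (Sym M)
     {(sym_incl M (b i) \<otimes>\<^bsub>Sym M\<^esub> sym_incl M (b i), \<zero>\<^bsub>Sym M\<^esub>) | i. i \<in> I}"

definition ext :: "('s::idempotent_semifield, 'm) module \<Rightarrow> 'i set \<Rightarrow> ('i \<Rightarrow> 'm) \<Rightarrow>
    ('s, ('m multiset \<Rightarrow>\<^sub>0 's) set set) module" where
  "ext M I b = quot (Sym M) (ext_cong M I b)"

definition ext_incl :: "('s::idempotent_semifield, 'm) module \<Rightarrow> 'i set \<Rightarrow> ('i \<Rightarrow> 'm) \<Rightarrow> 'm \<Rightarrow>
    ('m multiset \<Rightarrow>\<^sub>0 's) set set" where
  "ext_incl M I b x = ext_cong M I b `` {sym_incl M x}"

definition ext_deg :: "('s::idempotent_semifield, 'm) module \<Rightarrow> 'i set \<Rightarrow> ('i \<Rightarrow> 'm) \<Rightarrow> nat \<Rightarrow>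
    ('s, ('m multiset \<Rightarrow>\<^sub>0 's) set set) module" where
  "ext_deg M I b d = (ext M I b)\<lparr>carrier := {ext_cong M I b `` {z} | z. z \<in> sym_deg M d}\<rparr>"

text \<open>
  The map of Grassmann algebras induced by a linear map \<open>f\<close> into \<open>N\<close> which is compatible
  with the presentations; \<open>b\<close> is the family belonging to \<open>N\<close>.
\<close>

definition ext_map :: "('s::idempotent_semifield, 'n) module \<Rightarrow> 'i set \<Rightarrow> ('i \<Rightarrow> 'n) \<Rightarrow> ('m \<Rightarrow> 'n) \<Rightarrow>
    ('m multiset \<Rightarrow>\<^sub>0 's) set set \<Rightarrow> ('n multiset \<Rightarrow>\<^sub>0 's) set set" where
  "ext_map N I b f = quot_map (ext_cong N I b) (sym_map N f)"

definition wedge :: "('s::idempotent_semifield, 'm) module \<Rightarrow> 'i set \<Rightarrow> ('i \<Rightarrow> 'm) \<Rightarrow> 'i set \<Rightarrow>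
    ('m multiset \<Rightarrow>\<^sub>0 's) set set" where
  "wedge M I b J = (\<Otimes>\<^bsub>ext M I b\<^esub>j\<in>J. ext_incl M I b (b j))"

definition subsets_of_card :: "'i set \<Rightarrow> nat \<Rightarrow> 'i set set" where
  "subsets_of_card I d = {J. J \<subseteq> I \<and> card J = d}"


section \<open>Tropical Pluecker vectors and the module \<open>Q\<^sub>w\<close>\<close>

text \<open>From here on, \<open>V\<close> is meant to be free with basis \<open>e 1, \<dots>, e n\<close>.\<close>

abbreviation ext_pow :: "('s::idempotent_semifield, 'v) module \<Rightarrow> nat \<Rightarrow> (nat \<Rightarrow> 'v) \<Rightarrow> nat \<Rightarrow>
    ('s, ('v multiset \<Rightarrow>\<^sub>0 's) set set) module" where
  "ext_pow V n e d \<equiv> ext_deg V {1..n} e d"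

abbreviation dual_vec :: "('s::idempotent_semifield, 'v) module \<Rightarrow> nat \<Rightarrow> (nat \<Rightarrow> 'v) \<Rightarrow> nat \<Rightarrow> 'v \<Rightarrow> 's" where
  "dual_vec V n e \<equiv> dual_basis V {1..n} e"

definition pluecker_coord :: "('s::idempotent_semifield, 'v) module \<Rightarrow> nat \<Rightarrow> (nat \<Rightarrow> 'v) \<Rightarrow> nat \<Rightarrow>
    ('v multiset \<Rightarrow>\<^sub>0 's) set set \<Rightarrow> nat set \<Rightarrow> 's" where
  "pluecker_coord V n e d w =
     basis_coord (ext_pow V n e d) (subsets_of_card {1..n} d) (wedge V {1..n} e) w"

text \<open>
  The condition on \<open>card B\<close> is written so that for \<open>d = 0\<close> there is no \<open>B\<close>.
\<close>

definition tropical_pluecker :: "('s::idempotent_semifield, 'v) module \<Rightarrow> nat \<Rightarrow> (nat \<Rightarrow> 'v) \<Rightarrow> nat \<Rightarrow>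
    ('v multiset \<Rightarrow>\<^sub>0 's) set set \<Rightarrow> bool" where
  "tropical_pluecker V n e d w \<longleftrightarrow>
     w \<in> carrier (ext_pow V n e d) \<and> w \<noteq> \<zero>\<^bsub>ext_pow V n e d\<^esub> \<and>
     (let c = pluecker_coord V n e d w in
      \<forall>A B. A \<subseteq> {1..n} \<and> card A = d + 1 \<and> B \<subseteq> {1..n} \<and> card B + 1 = d \<longrightarrow>
        (\<forall>p \<in> A - B.
          (\<Sum>i\<in>A - B. c (A - {i}) * c (B \<union> {i})) =
          (\<Sum>i\<in>A - B - {p}. c (A - {i}) * c (B \<union> {i}))))"

text \<open>A linear form \<open>f\<close> on \<open>V\<close> has coefficients \<open>f (e i)\<close> with respect to the dual basis.\<close>

definition bend_rel :: "('s::idempotent_semifield, 'v) module \<Rightarrow> nat \<Rightarrow> (nat \<Rightarrow> 'v) \<Rightarrow> ('v \<Rightarrow> 's) \<Rightarrow>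
    (('v \<Rightarrow> 's) \<times> ('v \<Rightarrow> 's)) set" where
  "bend_rel V n e f =
     {(f, \<Oplus>\<^bsub>dual V\<^esub>i\<in>{1..n} - {j}. f (e i) \<odot>\<^bsub>dual V\<^esub> dual_vec V n e i) | j. j \<in> {1..n}}"

definition bend_cong :: "('s::idempotent_semifield, 'v) module \<Rightarrow> nat \<Rightarrow> (nat \<Rightarrow> 'v) \<Rightarrow>
    ('s, 'm) module \<Rightarrow> ('v \<Rightarrow> 'm) \<Rightarrow> (('v \<Rightarrow> 's) \<times> ('v \<Rightarrow> 's)) set" where
  "bend_cong V n e M \<phi> = module_cong_gen (dual V)
     (\<Union>f \<in> dual_map V \<phi> ` carrier (dual M). bend_rel V n e f)"

definition wedge_with :: "('s::idempotent_semifield, 'v) module \<Rightarrow> nat \<Rightarrow> (nat \<Rightarrow> 'v) \<Rightarrow>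
    ('v multiset \<Rightarrow>\<^sub>0 's) set set \<Rightarrow> 'v \<Rightarrow> ('v multiset \<Rightarrow>\<^sub>0 's) set set" where
  "wedge_with V n e w v = ext_incl V {1..n} e v \<otimes>\<^bsub>ext V {1..n} e\<^esub> w"

definition Q_cong :: "('s::idempotent_semifield, 'v) module \<Rightarrow> nat \<Rightarrow> (nat \<Rightarrow> 'v) \<Rightarrow> nat \<Rightarrow>
    ('v multiset \<Rightarrow>\<^sub>0 's) set set \<Rightarrow> (('v \<Rightarrow> 's) \<times> ('v \<Rightarrow> 's)) set" where
  "Q_cong V n e d w = bend_cong V n e (ext_pow V n e (d + 1)) (wedge_with V n e w)"

definition Q_mod :: "('s::idempotent_semifield, 'v) module \<Rightarrow> nat \<Rightarrow> (nat \<Rightarrow> 'v) \<Rightarrow> nat \<Rightarrow>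
    ('v multiset \<Rightarrow>\<^sub>0 's) set set \<Rightarrow> ('s, ('v \<Rightarrow> 's) set) module" where
  "Q_mod V n e d w = quot (dual V) (Q_cong V n e d w)"

definition Q_proj :: "('s::idempotent_semifield, 'v) module \<Rightarrow> nat \<Rightarrow> (nat \<Rightarrow> 'v) \<Rightarrow> nat \<Rightarrow>
    ('v multiset \<Rightarrow>\<^sub>0 's) set set \<Rightarrow> ('v \<Rightarrow> 's) \<Rightarrow> ('v \<Rightarrow> 's) set" where
  "Q_proj V n e d w f = Q_cong V n e d w `` {f}"

text \<open>The tropical linear space \<open>L\<^sub>w\<close>: the dual of \<open>Q\<^sub>w\<close>, viewed inside \<open>V \<cong> V\<^sup>\<or>\<^sup>\<or>\<close>.\<close>

definition tropical_linear_space :: "('s::idempotent_semifield, 'v) module \<Rightarrow> nat \<Rightarrow> (nat \<Rightarrow> 'v) \<Rightarrow> nat \<Rightarrow>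
    ('v multiset \<Rightarrow>\<^sub>0 's) set set \<Rightarrow> 'v set" where
  "tropical_linear_space V n e d w = {v \<in> carrier V.
     (\<lambda>f\<in>carrier (dual V). f v) \<in> dual_map (dual V) (Q_proj V n e d w) ` carrier (dual (Q_mod V n e d w))}"

abbreviation dual_ext_pow :: "('s::idempotent_semifield, 'v) module \<Rightarrow> nat \<Rightarrow> (nat \<Rightarrow> 'v) \<Rightarrow> nat \<Rightarrow>
    ('s, (('v \<Rightarrow> 's) multiset \<Rightarrow>\<^sub>0 's) set set) module" where
  "dual_ext_pow V n e d \<equiv> ext_deg (dual V) {1..n} (dual_vec V n e) d"

abbreviation Q_ext_pow :: "('s::idempotent_semifield, 'v) module \<Rightarrow> nat \<Rightarrow> (nat \<Rightarrow> 'v) \<Rightarrow> nat \<Rightarrow>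
    ('v multiset \<Rightarrow>\<^sub>0 's) set set \<Rightarrow> ('s, (('v \<Rightarrow> 's) set multiset \<Rightarrow>\<^sub>0 's) set set) module" where
  "Q_ext_pow V n e d w \<equiv>
     ext_deg (Q_mod V n e d w) {1..n} (\<lambda>i. Q_proj V n e d w (dual_vec V n e i)) d"

abbreviation ext_proj :: "('s::idempotent_semifield, 'v) module \<Rightarrow> nat \<Rightarrow> (nat \<Rightarrow> 'v) \<Rightarrow> nat \<Rightarrow>
    ('v multiset \<Rightarrow>\<^sub>0 's) set set \<Rightarrow>
    (('v \<Rightarrow> 's) multiset \<Rightarrow>\<^sub>0 's) set set \<Rightarrow> (('v \<Rightarrow> 's) set multiset \<Rightarrow>\<^sub>0 's) set set" where
  "ext_proj V n e d w \<equiv>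
     ext_map (Q_mod V n e d w) {1..n} (\<lambda>i. Q_proj V n e d w (dual_vec V n e i)) (Q_proj V n e d w)"

text \<open>
  The canonical isomorphism from the dual of the \<open>d\<close>-th exterior power of \<open>V\<^sup>\<or>\<close> to the \<open>d\<close>-th
  exterior power of \<open>V\<close>, under which the monomials \<open>e\<^sub>J\<close> form the basis dual to the
  monomials \<open>x\<^sub>J\<close>.
\<close>

definition canonical_iso :: "('s::idempotent_semifield, 'v) module \<Rightarrow> nat \<Rightarrow> (nat \<Rightarrow> 'v) \<Rightarrow> nat \<Rightarrow>
    ((('v \<Rightarrow> 's) multiset \<Rightarrow>\<^sub>0 's) set set \<Rightarrow> 's) \<Rightarrow> ('v multiset \<Rightarrow>\<^sub>0 's) set set" where
  "canonical_iso V n e d \<phi> =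
     (\<Oplus>\<^bsub>ext_pow V n e d\<^esub>J\<in>subsets_of_card {1..n} d.
        \<phi> (wedge (dual V) {1..n} (dual_vec V n e) J) \<odot>\<^bsub>ext_pow V n e d\<^esub> wedge V {1..n} e J)"

end

theory Submission
  imports Defs
begin

text \<open>
  The images of \<open>x\<^sub>1, \<dots>, x\<^sub>n\<close> span \<open>Q\<^sub>w\<close> and their squares vanish in its Grassmann algebra, so a
  linear functional on the \<open>d\<close>-th exterior power of \<open>Q\<^sub>w\<close> is determined by its values \<open>y\<^sub>J\<close> on the
  square-free monomials \<open>x\<^sub>J\<close>, and its image in the exterior power of \<open>V\<close> is the sum of the
  \<open>y\<^sub>J e\<^sub>J\<close>. The linear forms in the image of the dual of \<open>- \<and> w\<close> are the combinations of the forms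
  \<open>f\<^sub>A = \<Sum>\<^sub>i w(A - i) x\<^sub>i\<close>, where \<open>A\<close> has \<open>d + 1\<close> elements. Multiplying a bend relation of \<open>f\<^sub>A\<close> by
  \<open>x\<^sub>B\<close>, where \<open>B\<close> has \<open>d - 1\<close> elements, shows what a family \<open>y\<close> has to satisfy in order to come
  from a functional: the sum over \<open>i \<in> A - B\<close> of \<open>w(A - i) y(B + i)\<close> must not change when one of its
  terms is dropped. This is the tropical Pluecker relation with one of the two factors replaced by
  \<open>y\<close>; below such a \<open>y\<close> is called incident to \<open>w\<close>. The Pluecker relations say that \<open>w\<close> is incident
  to itself, so the theorem amounts to the fact that every \<open>y\<close> incident to \<open>w\<close> is a multiple of \<open>w\<close>
  (\<open>incident_proportional\<close>). For index sets \<open>B + i\<close> and \<open>B + j\<close> the relation for \<open>A = B + i + j\<close> has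
  only two terms, and it says that \<open>w(B + j) y(B + i) = w(B + i) y(B + j)\<close>. The general relation
  provides exchange steps as in a matroid: they lead from any index set at which \<open>w\<close> does not vanish
  to any one at which \<open>w\<close> or \<open>y\<close> does not vanish, and on the way each index set differs from the
  previous one by a single element and \<open>w\<close> never vanishes.

  That the values of a functional are incident to \<open>w\<close> (\<open>functional_values_incident\<close>) only uses
  relations that hold in the quotient. To construct a functional on the quotient
  (\<open>functional_exists\<close>) one has to control all relations that follow from the given ones, through
  three layers of generated congruences. Here the following observation helps: for a linear
  functional \<open>\<mu>\<close> on an algebra, the pairs \<open>(p, q)\<close> with \<open>\<mu> (u p) = \<mu> (u q)\<close> for all \<open>u\<close> form an
  algebra congruence that is contained in the kernel of \<open>\<mu>\<close>, so it suffices to look at the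
  generating relations (\<open>ext_dual_exists\<close>). Taking a coefficient of a square-free monomial for \<open>\<mu>\<close>
  proves that the \<open>e\<^sub>J\<close> are linearly independent, hence that \<open>w\<close> has well-defined coordinates; taking
  the combination of these coefficients with weights \<open>a w\<^sub>J\<close> yields the functional that corresponds to
  \<open>a w\<close>.
\<close>

section \<open>Polynomials and substitution\<close>

abbreviation const :: "'s \<Rightarrow> ('m multiset \<Rightarrow>\<^sub>0 's::idempotent_semifield)" where
  "const a \<equiv> Poly_Mapping.single {#} a"

lemma const_add: "const (a + b) = const a + const b"
  by (simp add: single_add)

lemma const_mult: "const (a * b) = const a * const b"
  by (simp add: mult_single)

lemma lookup_const_mult: "Poly_Mapping.lookup (const a * p) m = a * Poly_Mapping.lookup p m"
  unfolding mult_map_scale_conv_mult[symmetric] by (simp add: Poly_Mapping.map.rep_eq when_def)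

lemma const_mult_single: "const a * Poly_Mapping.single m b = Poly_Mapping.single m (a * b)"
  by (simp add: mult_single)

lemma poly_eq_sum_monomials:
  fixes p :: "'m \<Rightarrow>\<^sub>0 'a::comm_monoid_add"
  shows "(\<Sum>m\<in>Poly_Mapping.keys p. Poly_Mapping.single m (Poly_Mapping.lookup p m)) = p"
  by (rule poly_mapping_eqI)
    (simp add: lookup_sum lookup_single when_def not_in_keys_iff_lookup_eq_zero)

text \<open>
  Only monomials of \<open>p\<close> itself have to be added, so the induction can be used for statements about
  polynomials whose monomials are restricted.
\<close>

lemma poly_induct [case_names zero add]:
  fixes p :: "'m \<Rightarrow>\<^sub>0 'a::comm_monoid_add"
  assumes zero: "P 0"
    and add: "\<And>m q. m \<in> Poly_Mapping.keys p \<Longrightarrow> P q \<Longrightarrow>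
      P (Poly_Mapping.single m (Poly_Mapping.lookup p m) + q)"
  shows "P p"
proof -
  have "P (\<Sum>m\<in>F. Poly_Mapping.single m (Poly_Mapping.lookup p m))"
    if "finite F" "F \<subseteq> Poly_Mapping.keys p" for F
    using that by (induction rule: finite_induct) (auto intro: zero add)
  from this[of "Poly_Mapping.keys p"] show ?thesis
    by (simp add: poly_eq_sum_monomials)
qed

text \<open>
  The algebra homomorphism between polynomial algebras that sends each variable \<open>x\<close> to \<open>L x\<close>. It
  covers the functorial maps between free algebras as well as the passage from polynomials in
  elements of a module to polynomials in coordinates.
\<close>

definition poly_subst :: "('m \<Rightarrow> ('k multiset \<Rightarrow>\<^sub>0 's)) \<Rightarrow> ('m multiset \<Rightarrow>\<^sub>0 's) \<Rightarrow>
    ('k multiset \<Rightarrow>\<^sub>0 's::idempotent_semifield)" where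
  "poly_subst L p = (\<Sum>m\<in>Poly_Mapping.keys p. const (Poly_Mapping.lookup p m) * (\<Prod>x\<in>#m. L x))"

lemma poly_subst_superset:
  assumes "finite F" "Poly_Mapping.keys p \<subseteq> F"
  shows "poly_subst L p = (\<Sum>m\<in>F. const (Poly_Mapping.lookup p m) * (\<Prod>x\<in>#m. L x))"
  unfolding poly_subst_def using assms
  by (intro sum.mono_neutral_left) (auto simp: not_in_keys_iff_lookup_eq_zero)

lemma poly_subst_add: "poly_subst L (p + q) = poly_subst L p + poly_subst L q"
proof -
  let ?F = "Poly_Mapping.keys p \<union> Poly_Mapping.keys q"
  have "poly_subst L r = (\<Sum>m\<in>?F. const (Poly_Mapping.lookup r m) * (\<Prod>x\<in>#m. L x))"
    if "r \<in> {p, q, p + q}" for r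
    using that Poly_Mapping.keys_add[of p q] by (intro poly_subst_superset) auto
  then show ?thesis
    by (simp add: lookup_add const_add distrib_right sum.distrib)
qed

lemma poly_subst_single: "poly_subst L (Poly_Mapping.single m a) = const a * (\<Prod>x\<in>#m. L x)"
  by (simp add: poly_subst_superset[of "{m}"])

lemma poly_subst_zero: "poly_subst L 0 = 0"
  by (simp add: poly_subst_def)

lemma poly_subst_one: "poly_subst L 1 = 1"
  using poly_subst_single[of L "{#}" 1] by simp

lemma poly_subst_free_var: "poly_subst L (free_var x) = L x"
  by (simp add: free_var_def poly_subst_single)

lemma poly_subst_mult: "poly_subst L (p * q) = poly_subst L p * poly_subst L q"
proof (induction p rule: poly_induct)
  case zero
  show ?case by (simp add: poly_subst_zero)
next
  case (add m p')
  have "poly_subst L (Poly_Mapping.single m a * q) = poly_subst L (Poly_Mapping.single m a) * poly_subst L q" for a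
  proof (induction q rule: poly_induct)
    case zero
    show ?case by (simp add: poly_subst_zero)
  next
    case (add k q')
    have "poly_subst L (Poly_Mapping.single m a * Poly_Mapping.single k b) =
        poly_subst L (Poly_Mapping.single m a) * poly_subst L (Poly_Mapping.single k b)" for b
      by (subst mult_single) (simp add: poly_subst_single const_mult ac_simps)
    with add show ?case
      by (simp add: distrib_left poly_subst_add)
  qed
  with add show ?case
    by (simp add: distrib_right poly_subst_add)
qed

lemma poly_subst_const_mult: "poly_subst L (const a * p) = const a * poly_subst L p"
  by (simp add: poly_subst_mult poly_subst_single)

lemma poly_subst_sum: "poly_subst L (\<Sum>i\<in>F. g i) = (\<Sum>i\<in>F. poly_subst L (g i))"
  by (induction F rule: infinite_finite_induct) (auto simp: poly_subst_zero poly_subst_add)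

lemma poly_subst_prod: "poly_subst L (\<Prod>i\<in>F. g i) = (\<Prod>i\<in>F. poly_subst L (g i))"
  by (induction F rule: infinite_finite_induct) (auto simp: poly_subst_one poly_subst_mult)

lemma prod_single_variables:
  "(\<Prod>x\<in>#m. Poly_Mapping.single {#f x#} 1) = Poly_Mapping.single (image_mset f m) (1::'s::idempotent_semifield)"
proof (induction m)
  case empty
  show ?case by simp
next
  case (add x m)
  then show ?case by (simp add: mult_single)
qed

lemma free_map_eq_poly_subst: "free_map f = poly_subst (\<lambda>x. free_var (f x))"
  by (rule ext) (simp add: free_map_def poly_subst_def free_var_def prod_single_variables mult_single)

lemma prod_free_var: "(\<Prod>j\<in>J. free_var (b j)) = (Poly_Mapping.single (image_mset b (mset_set J)) 1 :: _ \<Rightarrow>\<^sub>0 's::idempotent_semifield)"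
  unfolding free_var_def prod_unfold_prod_mset by (rule prod_single_variables)

definition forms :: "'m set \<Rightarrow> nat \<Rightarrow> ('m multiset \<Rightarrow>\<^sub>0 's::idempotent_semifield) set" where
  "forms X d = {p. \<forall>m\<in>Poly_Mapping.keys p. set_mset m \<subseteq> X \<and> size m = d}"

abbreviation polys :: "'m set \<Rightarrow> ('m multiset \<Rightarrow>\<^sub>0 's::idempotent_semifield) set" where
  "polys X \<equiv> carrier (free_comm_algebra X)"

lemma free_comm_algebra_simps [simp]:
  "p \<otimes>\<^bsub>free_comm_algebra X\<^esub> q = p * q"
  "p \<oplus>\<^bsub>free_comm_algebra X\<^esub> q = p + q"
  "a \<odot>\<^bsub>free_comm_algebra X\<^esub> p = const a * p"
  "\<zero>\<^bsub>free_comm_algebra X\<^esub> = 0"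
  "\<one>\<^bsub>free_comm_algebra X\<^esub> = 1"
  by (simp_all add: free_comm_algebra_def)

lemma polys_iff: "p \<in> polys X \<longleftrightarrow> (\<forall>m\<in>Poly_Mapping.keys p. set_mset m \<subseteq> X)"
  by (simp add: free_comm_algebra_def)

lemma polys_add: "p \<in> polys X \<Longrightarrow> q \<in> polys X \<Longrightarrow> p + q \<in> polys X"
  unfolding polys_iff using Poly_Mapping.keys_add[of p q] by blast

lemma polys_mult: "p \<in> polys X \<Longrightarrow> q \<in> polys X \<Longrightarrow> p * q \<in> polys X"
  unfolding polys_iff using keys_mult[of p q] by fastforce

lemma polys_const: "const a \<in> polys X"
  by (simp add: polys_iff)

lemma polys_zero: "0 \<in> polys X"
  by (simp add: polys_iff)

lemma polys_one: "1 \<in> polys X"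
  by (simp add: polys_iff)

lemma polys_free_var: "x \<in> X \<Longrightarrow> free_var x \<in> polys X"
  by (simp add: polys_iff free_var_def)

lemma polys_sum: "(\<And>i. i \<in> F \<Longrightarrow> g i \<in> polys X) \<Longrightarrow> (\<Sum>i\<in>F. g i) \<in> polys X"
  by (induction F rule: infinite_finite_induct) (auto intro: polys_zero polys_add)

lemma polys_prod: "(\<And>i. i \<in> F \<Longrightarrow> g i \<in> polys X) \<Longrightarrow> (\<Prod>i\<in>F. g i) \<in> polys X"
  by (induction F rule: infinite_finite_induct) (auto intro: polys_one polys_mult)

lemmas polys_intros = polys_add polys_mult polys_const polys_zero polys_one polys_free_var
  polys_sum polys_prod

lemma forms_subset_polys: "p \<in> forms X d \<Longrightarrow> p \<in> polys X"
  by (simp add: forms_def polys_iff)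

lemma forms_zero: "0 \<in> forms X d"
  by (simp add: forms_def)

lemma forms_add: "p \<in> forms X d \<Longrightarrow> q \<in> forms X d \<Longrightarrow> p + q \<in> forms X d"
  unfolding forms_def using Poly_Mapping.keys_add[of p q] by blast

lemma forms_mult: "p \<in> forms X c \<Longrightarrow> q \<in> forms X d \<Longrightarrow> p * q \<in> forms X (c + d)"
  unfolding forms_def using keys_mult[of p q] by fastforce

lemma forms_const: "const a \<in> forms X 0"
  by (simp add: forms_def)

lemma forms_const_mult: "p \<in> forms X d \<Longrightarrow> const a * p \<in> forms X d"
  using forms_mult[OF forms_const] by fastforce

lemma forms_free_var: "x \<in> X \<Longrightarrow> free_var x \<in> forms X 1"
  by (simp add: forms_def free_var_def)

lemma forms_free_var_mult: "x \<in> X \<Longrightarrow> p \<in> forms X d \<Longrightarrow> free_var x * p \<in> forms X (Suc d)"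
  using forms_mult[OF forms_free_var] by fastforce

lemma forms_sum: "(\<And>i. i \<in> F \<Longrightarrow> g i \<in> forms X d) \<Longrightarrow> (\<Sum>i\<in>F. g i) \<in> forms X d"
  by (induction F rule: infinite_finite_induct) (auto intro: forms_zero forms_add)

lemma forms_prod_free_var:
  assumes "b \<in> J \<rightarrow> X" "finite J"
  shows "(\<Prod>j\<in>J. free_var (b j)) \<in> forms X (card J)"
  unfolding prod_free_var forms_def using assms by auto

text \<open>
  A square-free monomial is not divisible by the square of a variable. This is why its coefficient
  is a functional that respects the relations \<open>x\<^sub>i\<^sup>2 \<sim> 0\<close>.
\<close>

lemma lookup_mult_square:
  assumes "count m i \<le> 1"
  shows "Poly_Mapping.lookup (u * (free_var i * free_var i)) m = (0::'s::idempotent_semifield)"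
proof (rule ccontr)
  assume "Poly_Mapping.lookup (u * (free_var i * free_var i)) m \<noteq> (0::'s)"
  then have "m \<in> Poly_Mapping.keys (u * (free_var i * free_var i))"
    by (simp add: in_keys_iff)
  then obtain k l where "m = k + l" "l \<in> Poly_Mapping.keys (free_var i * free_var i :: 'a multiset \<Rightarrow>\<^sub>0 's)"
    using keys_mult by blast
  then have "m = k + {#i, i#}"
    by (auto simp: free_var_def mult_single)
  with assms show False by simp
qed

lemma prod_variables: "(\<Prod>j\<in>J. free_var j) = (Poly_Mapping.single (mset_set J) 1 :: _ \<Rightarrow>\<^sub>0 's::idempotent_semifield)"
  using prod_free_var[of "\<lambda>j. j" J] by simp

lemma count_mset_set_le_one: "count (mset_set J) i \<le> 1"
  by (cases "finite J"; cases "i \<in> J") auto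

lemma mset_set_eq_iff: "finite J \<Longrightarrow> finite K \<Longrightarrow> mset_set J = mset_set K \<longleftrightarrow> J = K"
  by (metis finite_set_mset_mset_set)

lemma poly_subst_polys:
  assumes "p \<in> polys X" "\<And>x. x \<in> X \<Longrightarrow> L x \<in> polys Y"
  shows "poly_subst L p \<in> polys Y"
proof -
  have "(\<Prod>x\<in>#m. L x) \<in> polys Y" if "set_mset m \<subseteq> X" for m
    using that by (induction m) (auto intro!: polys_intros assms(2))
  then show ?thesis
    unfolding poly_subst_def using assms(1) by (intro polys_sum polys_mult polys_const) (auto simp: polys_iff)
qed

lemma free_map_forms:
  assumes "p \<in> forms X d" "f \<in> X \<rightarrow> Y"
  shows "free_map f p \<in> forms Y d"
  unfolding free_map_def using assms
  by (intro forms_sum) (force simp: forms_def)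


section \<open>Generated congruences and quotients\<close>

lemma algebra_cong_gen_least:
  "algebra_congruence A r \<Longrightarrow> R \<subseteq> r \<Longrightarrow> algebra_cong_gen A R \<subseteq> r"
  unfolding algebra_cong_gen_def by blast

lemma algebra_cong_gen_contains: "R \<subseteq> algebra_cong_gen A R"
  unfolding algebra_cong_gen_def by blast

lemma module_cong_gen_least:
  "module_congruence M r \<Longrightarrow> R \<subseteq> r \<Longrightarrow> module_cong_gen M R \<subseteq> r"
  unfolding module_cong_gen_def by blast

lemma module_cong_gen_contains: "R \<subseteq> module_cong_gen M R"
  unfolding module_cong_gen_def by blast

lemma equiv_Inter:
  assumes "\<R> \<noteq> {}" "\<And>r. r \<in> \<R> \<Longrightarrow> equiv A r"
  shows "equiv A (\<Inter>\<R>)"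
proof (rule equivI)
  show "\<Inter>\<R> \<subseteq> A \<times> A" using assms unfolding equiv_def by blast
  show "refl_on A (\<Inter>\<R>)" using assms(2) unfolding equiv_def refl_on_def by blast
  show "sym (\<Inter>\<R>)" using assms(2) unfolding equiv_def sym_def by blast
  show "trans (\<Inter>\<R>)" using assms(2) unfolding equiv_def trans_def by blast
qed

lemma module_congruence_gen:
  assumes "module_congruence M (carrier M \<times> carrier M)" "R \<subseteq> carrier M \<times> carrier M"
  shows "module_congruence M (module_cong_gen M R)"
proof -
  have "equiv (carrier M) (module_cong_gen M R)"
    unfolding module_cong_gen_def using assms
    by (intro equiv_Inter) (auto simp: module_congruence_def)
  then show ?thesis
    unfolding module_congruence_def by (simp add: module_cong_gen_def module_congruence_def)
qed

lemma algebra_congruence_gen: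
  assumes "algebra_congruence A (carrier A \<times> carrier A)" "R \<subseteq> carrier A \<times> carrier A"
  shows "algebra_congruence A (algebra_cong_gen A R)"
proof -
  have "equiv (carrier A) (algebra_cong_gen A R)"
    unfolding algebra_cong_gen_def using assms
    by (intro equiv_Inter) (auto simp: algebra_congruence_def module_congruence_def)
  then show ?thesis
    unfolding algebra_congruence_def module_congruence_def
    by (simp add: algebra_cong_gen_def algebra_congruence_def module_congruence_def)
qed

context
  fixes M :: "('s::idempotent_semifield, 'm) module" and r
  assumes cong: "module_congruence M r"
begin

lemma cong_equiv: "equiv (carrier M) r"
  using cong by (simp add: module_congruence_def)

lemma cong_add: "(x, x') \<in> r \<Longrightarrow> (y, y') \<in> r \<Longrightarrow> (x \<oplus>\<^bsub>M\<^esub> y, x' \<oplus>\<^bsub>M\<^esub> y') \<in> r"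
  using cong by (simp add: module_congruence_def)

lemma cong_smult: "(x, x') \<in> r \<Longrightarrow> (a \<odot>\<^bsub>M\<^esub> x, a \<odot>\<^bsub>M\<^esub> x') \<in> r"
  using cong by (simp add: module_congruence_def)

lemma cong_class_eq_iff: "x \<in> carrier M \<Longrightarrow> y \<in> carrier M \<Longrightarrow> r `` {x} = r `` {y} \<longleftrightarrow> (x, y) \<in> r"
  using eq_equiv_class_iff[OF cong_equiv] .

lemma quot_add:
  assumes "x \<in> carrier M" "y \<in> carrier M"
  shows "r `` {x} \<oplus>\<^bsub>quot M r\<^esub> r `` {y} = r `` {x \<oplus>\<^bsub>M\<^esub> y}"
proof -
  have "congruent2 r r (\<lambda>x y. r `` {x \<oplus>\<^bsub>M\<^esub> y})"
    by (auto simp: congruent2_def simp del: Image_singleton_iff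
        intro!: equiv_class_eq[OF cong_equiv] cong_add)
  from UN_equiv_class2[OF cong_equiv cong_equiv this assms] show ?thesis
    by (simp add: quot_def)
qed

lemma quot_smult:
  assumes "x \<in> carrier M"
  shows "a \<odot>\<^bsub>quot M r\<^esub> r `` {x} = r `` {a \<odot>\<^bsub>M\<^esub> x}"
proof -
  have "congruent r (\<lambda>x. r `` {a \<odot>\<^bsub>M\<^esub> x})"
    by (auto simp: congruent_def simp del: Image_singleton_iff
        intro!: equiv_class_eq[OF cong_equiv] cong_smult)
  from UN_equiv_class[OF cong_equiv this assms] show ?thesis
    by (simp add: quot_def)
qed

end

lemma quot_zero: "\<zero>\<^bsub>quot M r\<^esub> = r `` {\<zero>\<^bsub>M\<^esub>}"
  by (simp add: quot_def)

lemma quot_one: "\<one>\<^bsub>quot M r\<^esub> = r `` {\<one>\<^bsub>M\<^esub>}"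
  by (simp add: quot_def)

lemma quot_carrier: "carrier (quot M r) = (\<lambda>x. r `` {x}) ` carrier M"
  by (auto simp: quot_def quotient_def)

lemma algebra_cong_module: "algebra_congruence A r \<Longrightarrow> module_congruence A r"
  by (simp add: algebra_congruence_def)

lemma cong_mult:
  "algebra_congruence A r \<Longrightarrow> (x, x') \<in> r \<Longrightarrow> (y, y') \<in> r \<Longrightarrow> (x \<otimes>\<^bsub>A\<^esub> y, x' \<otimes>\<^bsub>A\<^esub> y') \<in> r"
  by (simp add: algebra_congruence_def)

lemma quot_mult:
  assumes "algebra_congruence A r" "x \<in> carrier A" "y \<in> carrier A"
  shows "r `` {x} \<otimes>\<^bsub>quot A r\<^esub> r `` {y} = r `` {x \<otimes>\<^bsub>A\<^esub> y}"
proof -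
  have eq: "equiv (carrier A) r"
    using assms cong_equiv algebra_cong_module by blast
  have "congruent2 r r (\<lambda>x y. r `` {x \<otimes>\<^bsub>A\<^esub> y})"
    unfolding congruent2_def by (auto intro!: equiv_class_eq[OF eq] cong_mult[OF assms(1)])
  from UN_equiv_class2[OF eq eq this assms(2,3)] show ?thesis
    by (simp add: quot_def)
qed

lemma quot_map_class:
  assumes r: "equiv X r" and s: "equiv Y s" and x: "x \<in> X"
    and f: "\<And>x y. (x, y) \<in> r \<Longrightarrow> (f x, f y) \<in> s"
  shows "quot_map s f (r `` {x}) = s `` {f x}"
proof -
  have "s `` {f y} = s `` {f x}" if "y \<in> r `` {x}" for y
    using that f[of x y] equiv_class_eq[OF s] by blast
  moreover have "x \<in> r `` {x}"
    using equiv_class_self[OF r x] .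
  ultimately show ?thesis
    unfolding quot_map_def by blast
qed

lemma equiv_full_relation: "equiv X (X \<times> X)"
  by (intro equivI refl_onI symI transI) auto

text \<open>
  Generated congruences are intersections, and these are congruences only if there is at least one
  congruence to intersect. This is why closedness of a carrier is expressed by saying that the full
  relation on it is a congruence.
\<close>

lemma closed_under_operations_iff:
  "algebra_congruence A (carrier A \<times> carrier A) \<longleftrightarrow>
     (\<forall>x\<in>carrier A. \<forall>y\<in>carrier A. x \<oplus>\<^bsub>A\<^esub> y \<in> carrier A \<and> x \<otimes>\<^bsub>A\<^esub> y \<in> carrier A) \<and>
     (\<forall>a. \<forall>x\<in>carrier A. a \<odot>\<^bsub>A\<^esub> x \<in> carrier A)" (is "?C \<longleftrightarrow> ?P")
proof
  assume c: ?C
  note ops = cong_add[OF algebra_cong_module[OF c]] cong_mult[OF c] cong_smult[OF algebra_cong_module[OF c]]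
  have "x \<oplus>\<^bsub>A\<^esub> y \<in> carrier A \<and> x \<otimes>\<^bsub>A\<^esub> y \<in> carrier A"
    if "x \<in> carrier A" "y \<in> carrier A" for x y
    using ops(1,2)[of x x y y] that by simp
  moreover have "a \<odot>\<^bsub>A\<^esub> x \<in> carrier A" if "x \<in> carrier A" for a x
    using ops(3)[of x x a] that by simp
  ultimately show ?P by simp
next
  assume ?P
  then show ?C
    unfolding algebra_congruence_def module_congruence_def
    by (intro conjI equiv_full_relation allI impI) simp_all
qed

lemma free_comm_algebra_closed:
  "algebra_congruence (free_comm_algebra X) (polys X \<times> polys X)"
  unfolding closed_under_operations_iff by (auto intro: polys_intros)

lemma quot_closed:
  assumes A: "algebra_congruence A (carrier A \<times> carrier A)" and r: "algebra_congruence A r"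
  shows "algebra_congruence (quot A r) (carrier (quot A r) \<times> carrier (quot A r))"
proof -
  note q = quot_add[OF algebra_cong_module[OF r]] quot_smult[OF algebra_cong_module[OF r]]
    quot_mult[OF r]
  show ?thesis
    using A unfolding closed_under_operations_iff unfolding quot_carrier by (simp add: q)
qed


section \<open>Quotients and duals of semimodules\<close>

lemma semimodule_closed:
  "semimodule M \<Longrightarrow> module_congruence M (carrier M \<times> carrier M)"
proof -
  assume "semimodule M"
  then interpret semimodule M .
  show ?thesis
    unfolding module_congruence_def
    by (intro conjI equiv_full_relation allI impI) (simp_all add: smult_closed)
qed

lemma semimodule_quot:
  fixes M :: "('s::idempotent_semifield, 'm) module"
  assumes "semimodule M" and r: "module_congruence M r"
  shows "semimodule (quot M r)"
proof -
  interpret semimodule M by fact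
  note q = quot_carrier quot_add[OF r] quot_smult[OF r] quot_zero
  show ?thesis
  proof (intro semimodule.intro abelian_monoidI semimodule_axioms.intro)
    fix x y z :: "'m set" and a c :: 's
    assume x: "x \<in> carrier (quot M r)"
    then show "a \<odot>\<^bsub>quot M r\<^esub> x \<in> carrier (quot M r)"
      by (auto simp: q smult_closed)
    from x show "(a + c) \<odot>\<^bsub>quot M r\<^esub> x = a \<odot>\<^bsub>quot M r\<^esub> x \<oplus>\<^bsub>quot M r\<^esub> c \<odot>\<^bsub>quot M r\<^esub> x"
      by (auto simp: q smult_closed smult_l_distr)
    from x show "(a * c) \<odot>\<^bsub>quot M r\<^esub> x = a \<odot>\<^bsub>quot M r\<^esub> (c \<odot>\<^bsub>quot M r\<^esub> x)"
      by (auto simp: q smult_closed smult_assoc)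
    from x show "1 \<odot>\<^bsub>quot M r\<^esub> x = x" "0 \<odot>\<^bsub>quot M r\<^esub> x = \<zero>\<^bsub>quot M r\<^esub>" "\<zero>\<^bsub>quot M r\<^esub> \<oplus>\<^bsub>quot M r\<^esub> x = x"
      by (auto simp: q smult_one smult_l_null)
    assume y: "y \<in> carrier (quot M r)"
    from x y show "x \<oplus>\<^bsub>quot M r\<^esub> y \<in> carrier (quot M r)"
      by (auto simp: q)
    from x y show "x \<oplus>\<^bsub>quot M r\<^esub> y = y \<oplus>\<^bsub>quot M r\<^esub> x"
      by (auto simp: q a_comm)
    from x y show "a \<odot>\<^bsub>quot M r\<^esub> (x \<oplus>\<^bsub>quot M r\<^esub> y) = a \<odot>\<^bsub>quot M r\<^esub> x \<oplus>\<^bsub>quot M r\<^esub> a \<odot>\<^bsub>quot M r\<^esub> y"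
      by (auto simp: q smult_closed smult_r_distr)
    assume z: "z \<in> carrier (quot M r)"
    from x y z show "x \<oplus>\<^bsub>quot M r\<^esub> y \<oplus>\<^bsub>quot M r\<^esub> z = x \<oplus>\<^bsub>quot M r\<^esub> (y \<oplus>\<^bsub>quot M r\<^esub> z)"
      by (auto simp: q a_assoc)
  qed (auto simp: q smult_r_null)
qed

lemma dual_simps:
  "f \<in> carrier (dual M) \<longleftrightarrow> f \<in> extensional (carrier M) \<and>
    (\<forall>x\<in>carrier M. \<forall>y\<in>carrier M. f (x \<oplus>\<^bsub>M\<^esub> y) = f x + f y) \<and>
    (\<forall>a. \<forall>x\<in>carrier M. f (a \<odot>\<^bsub>M\<^esub> x) = a * f x)"
  "\<zero>\<^bsub>dual M\<^esub> = (\<lambda>x\<in>carrier M. 0)"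
  "f \<oplus>\<^bsub>dual M\<^esub> g = (\<lambda>x\<in>carrier M. f x + g x)"
  "a \<odot>\<^bsub>dual M\<^esub> f = (\<lambda>x\<in>carrier M. a * f x)"
  by (simp_all add: dual_def)

lemma dual_restrictI:
  assumes "semimodule M"
    and "\<And>x y. x \<in> carrier M \<Longrightarrow> y \<in> carrier M \<Longrightarrow> f (x \<oplus>\<^bsub>M\<^esub> y) = f x + f y"
    and "\<And>a x. x \<in> carrier M \<Longrightarrow> f (a \<odot>\<^bsub>M\<^esub> x) = a * f x"
  shows "(\<lambda>x\<in>carrier M. f x) \<in> carrier (dual M)"
proof -
  interpret semimodule M by fact
  show ?thesis
    using assms by (simp add: dual_simps smult_closed)
qed

lemma dual_eqI:
  assumes "f \<in> extensional (carrier M)" "g \<in> extensional (carrier M)"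
    and "\<And>x. x \<in> carrier M \<Longrightarrow> f x = g x"
  shows "f = g"
  using assms by (rule extensionalityI)

lemma semimodule_dual:
  assumes "semimodule M"
  shows "semimodule (dual M)"
proof -
  interpret semimodule M by fact
  have ext: "f x = undefined" if "f \<in> carrier (dual M)" "x \<notin> carrier M" for f x
    using that by (simp add: dual_simps extensional_def)
  show ?thesis
    by (intro semimodule.intro abelian_monoidI semimodule_axioms.intro)
      (auto simp: dual_simps(2-4) ext fun_eq_iff restrict_def algebra_simps smult_closed,
        auto simp: dual_simps(1) algebra_simps smult_closed extensional_def)
qed

lemma dual_finsum:
  assumes "semimodule M" "h \<in> F \<rightarrow> carrier (dual M)"
  shows "(\<Oplus>\<^bsub>dual M\<^esub>i\<in>F. h i) = (\<lambda>x\<in>carrier M. \<Sum>i\<in>F. h i x)"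
proof -
  interpret D: semimodule "dual M"
    by (rule semimodule_dual) fact
  show ?thesis
    using assms(2)
    by (induction F rule: infinite_finite_induct)
      (auto simp: dual_simps(2) Pi_iff dual_simps(3) cong: restrict_cong)
qed

lemma (in semimodule) finsum_smult:
  "finite F \<Longrightarrow> v \<in> F \<rightarrow> carrier M \<Longrightarrow> a \<odot> (\<Oplus>i\<in>F. v i) = (\<Oplus>i\<in>F. a \<odot> v i)"
proof (induction F rule: finite_induct)
  case (insert i F)
  then show ?case
    by (simp add: Pi_iff smult_closed smult_r_distr)
qed (simp add: smult_r_null)

lemma (in semimodule) functional_finsum:
  assumes f: "f \<in> carrier (dual M)" and "v \<in> F \<rightarrow> carrier M"
  shows "f (\<Oplus>i\<in>F. c i \<odot> v i) = (\<Sum>i\<in>F. c i * f (v i))"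
  using assms(2)
proof (induction F rule: infinite_finite_induct)
  case (insert i F)
  then have v: "v i \<in> carrier M" "c i \<odot> v i \<in> carrier M" "(\<Oplus>i\<in>F. c i \<odot> v i) \<in> carrier M"
    by (auto intro!: smult_closed finsum_closed)
  from insert have "f (\<Oplus>i\<in>insert i F. c i \<odot> v i) = f (c i \<odot> v i \<oplus> (\<Oplus>i\<in>F. c i \<odot> v i))"
    by (subst finsum_insert) (auto intro!: smult_closed)
  also have "\<dots> = f (c i \<odot> v i) + f (\<Oplus>i\<in>F. c i \<odot> v i)"
    using f v unfolding dual_simps by blast
  also have "f (c i \<odot> v i) = c i * f (v i)"
    using f v unfolding dual_simps by blast
  finally show ?case
    using insert by simp
next
  case empty
  have "f (0 \<odot> \<zero>) = 0 * f \<zero>"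
    using f unfolding dual_simps by blast
  then show ?case by (simp add: smult_r_null)
next
  case (infinite F)
  have "f (0 \<odot> \<zero>) = 0 * f \<zero>"
    using f unfolding dual_simps by blast
  with infinite show ?case by (simp add: smult_r_null)
qed


section \<open>The tropical Grassmann algebra as a quotient of a polynomial algebra\<close>

text \<open>
  A Grassmann algebra depends on a module and on a family of elements whose squares are
  killed. By its definition it is a quotient of the symmetric algebra, which is itself a quotient
  of the free algebra on the carrier. The map \<open>grass\<close> goes from the free algebra to the Grassmann
  algebra in one step, so that all calculations can be done with polynomials.
\<close>

definition grass :: "('s::idempotent_semifield, 'm) module \<Rightarrow> 'i set \<Rightarrow> ('i \<Rightarrow> 'm) \<Rightarrow>
    ('m multiset \<Rightarrow>\<^sub>0 's) \<Rightarrow> ('m multiset \<Rightarrow>\<^sub>0 's) set set" where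
  "grass M I b p = ext_cong M I b `` {sym_cong M `` {p}}"

locale semimodule_family = semimodule M
  for M :: "('s::idempotent_semifield, 'm) module" (structure) +
  fixes I :: "'i set" and b :: "'i \<Rightarrow> 'm"
  assumes family: "b \<in> I \<rightarrow> carrier M"
begin

lemma family_closed: "i \<in> I \<Longrightarrow> b i \<in> carrier M"
  using family by auto

abbreviation cls where "cls \<equiv> grass M I b"

abbreviation P :: "('m multiset \<Rightarrow>\<^sub>0 's) set" where "P \<equiv> polys (carrier M)"

lemma sym_rel_closed: "sym_rel M \<subseteq> P \<times> P"
  by (auto simp: sym_rel_def intro!: polys_intros smult_closed)

lemma sym_congruence: "algebra_congruence (free_comm_algebra (carrier M)) (sym_cong M)"
  unfolding sym_cong_def by (intro algebra_congruence_gen free_comm_algebra_closed sym_rel_closed)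

lemma Sym_carrier: "carrier (Sym M) = (\<lambda>p. sym_cong M `` {p}) ` P"
  by (simp add: Sym_def quot_carrier)

lemma Sym_closed: "algebra_congruence (Sym M) (carrier (Sym M) \<times> carrier (Sym M))"
  unfolding Sym_def by (intro quot_closed free_comm_algebra_closed sym_congruence)

lemma Sym_add: "p \<in> P \<Longrightarrow> q \<in> P \<Longrightarrow>
    sym_cong M `` {p} \<oplus>\<^bsub>Sym M\<^esub> sym_cong M `` {q} = sym_cong M `` {p + q}"
  unfolding Sym_def using quot_add[OF algebra_cong_module[OF sym_congruence], of p q] by simp

lemma Sym_mult: "p \<in> P \<Longrightarrow> q \<in> P \<Longrightarrow>
    sym_cong M `` {p} \<otimes>\<^bsub>Sym M\<^esub> sym_cong M `` {q} = sym_cong M `` {p * q}"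
  unfolding Sym_def using quot_mult[OF sym_congruence, of p q] by simp

lemma Sym_smult: "p \<in> P \<Longrightarrow> a \<odot>\<^bsub>Sym M\<^esub> sym_cong M `` {p} = sym_cong M `` {const a * p}"
  unfolding Sym_def using quot_smult[OF algebra_cong_module[OF sym_congruence], of p a] by simp

lemma Sym_zero: "\<zero>\<^bsub>Sym M\<^esub> = sym_cong M `` {0}"
  by (simp add: Sym_def quot_zero)

lemma Sym_one: "\<one>\<^bsub>Sym M\<^esub> = sym_cong M `` {1}"
  by (simp add: Sym_def quot_one)

lemma ext_rel_closed:
  "{(sym_incl M (b i) \<otimes>\<^bsub>Sym M\<^esub> sym_incl M (b i), \<zero>\<^bsub>Sym M\<^esub>) | i. i \<in> I}
     \<subseteq> carrier (Sym M) \<times> carrier (Sym M)"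
  using family
  by (auto simp: sym_incl_def Sym_mult Sym_zero Sym_carrier PiE polys_free_var polys_mult polys_zero
      dest: funcset_mem)

lemma ext_congruence: "algebra_congruence (Sym M) (ext_cong M I b)"
  unfolding ext_cong_def by (intro algebra_congruence_gen Sym_closed ext_rel_closed)

lemma ext_carrier: "carrier (ext M I b) = cls ` P"
  by (simp add: ext_def quot_carrier Sym_carrier image_image grass_def)

lemma ext_add: "p \<in> P \<Longrightarrow> q \<in> P \<Longrightarrow> cls p \<oplus>\<^bsub>ext M I b\<^esub> cls q = cls (p + q)"
  unfolding ext_def grass_def
  by (subst quot_add[OF algebra_cong_module[OF ext_congruence]]) (auto simp: Sym_carrier Sym_add)

lemma ext_mult: "p \<in> P \<Longrightarrow> q \<in> P \<Longrightarrow> cls p \<otimes>\<^bsub>ext M I b\<^esub> cls q = cls (p * q)"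
  unfolding ext_def grass_def
  by (subst quot_mult[OF ext_congruence]) (auto simp: Sym_carrier Sym_mult)

lemma ext_smult: "p \<in> P \<Longrightarrow> a \<odot>\<^bsub>ext M I b\<^esub> cls p = cls (const a * p)"
  unfolding ext_def grass_def
  by (subst quot_smult[OF algebra_cong_module[OF ext_congruence]]) (auto simp: Sym_carrier Sym_smult)

lemma ext_zero: "\<zero>\<^bsub>ext M I b\<^esub> = cls 0"
  by (simp add: ext_def quot_zero grass_def Sym_zero)

lemma ext_one: "\<one>\<^bsub>ext M I b\<^esub> = cls 1"
  by (simp add: ext_def quot_one grass_def Sym_one)

lemma ext_incl_eq: "ext_incl M I b x = cls (free_var x)"
  by (simp add: ext_incl_def grass_def sym_incl_def)

lemma cls_add_cong:
  "p \<in> P \<Longrightarrow> p' \<in> P \<Longrightarrow> q \<in> P \<Longrightarrow> q' \<in> P \<Longrightarrow> cls p = cls p' \<Longrightarrow> cls q = cls q' \<Longrightarrow>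
     cls (p + q) = cls (p' + q')"
  by (metis ext_add)

lemma cls_mult_cong:
  "p \<in> P \<Longrightarrow> p' \<in> P \<Longrightarrow> q \<in> P \<Longrightarrow> q' \<in> P \<Longrightarrow> cls p = cls p' \<Longrightarrow> cls q = cls q' \<Longrightarrow>
     cls (p * q) = cls (p' * q')"
  by (metis ext_mult)

lemma cls_eq_of_sym_rel:
  assumes "(p, q) \<in> sym_rel M"
  shows "cls p = cls q"
proof -
  have "(p, q) \<in> sym_cong M"
    using assms algebra_cong_gen_contains unfolding sym_cong_def by blast
  then have "sym_cong M `` {p} = sym_cong M `` {q}"
    by (rule equiv_class_eq[OF cong_equiv[OF algebra_cong_module[OF sym_congruence]]])
  then show ?thesis
    by (simp add: grass_def)
qed

lemma cls_add_var: "x \<in> carrier M \<Longrightarrow> y \<in> carrier M \<Longrightarrow> cls (free_var (x \<oplus> y)) = cls (free_var x + free_var y)"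
  by (rule cls_eq_of_sym_rel) (auto simp: sym_rel_def)

lemma cls_smult_var: "x \<in> carrier M \<Longrightarrow> cls (free_var (a \<odot> x)) = cls (const a * free_var x)"
  by (rule cls_eq_of_sym_rel) (auto simp: sym_rel_def)

lemma cls_zero_var: "cls (free_var \<zero>) = cls 0"
  using cls_smult_var[of "\<zero>" 0] by (simp add: smult_r_null)

lemma cls_square:
  assumes "i \<in> I"
  shows "cls (free_var (b i) * free_var (b i)) = cls 0"
proof -
  have "(sym_incl M (b i) \<otimes>\<^bsub>Sym M\<^esub> sym_incl M (b i), \<zero>\<^bsub>Sym M\<^esub>) \<in> ext_cong M I b"
    unfolding ext_cong_def using assms algebra_cong_gen_contains by fast
  then have "ext_cong M I b `` {sym_incl M (b i) \<otimes>\<^bsub>Sym M\<^esub> sym_incl M (b i)} = ext_cong M I b `` {\<zero>\<^bsub>Sym M\<^esub>}"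
    by (rule equiv_class_eq[OF cong_equiv[OF algebra_cong_module[OF ext_congruence]]])
  moreover have "free_var (b i) \<in> P"
    using family assms by (auto intro: polys_intros)
  ultimately show ?thesis
    by (simp add: sym_incl_def Sym_mult Sym_zero grass_def)
qed

text \<open>
  The two quotients combine into one: the kernel of \<open>grass\<close> is contained in every algebra
  congruence on the free algebra which contains both kinds of generating relations. Such a
  congruence \<open>r\<close> contains the congruence that defines the symmetric algebra, so it descends to a
  congruence \<open>t\<close> there, and \<open>t\<close> contains the congruence that defines the Grassmann algebra.
\<close>

lemma cls_eqD:
  assumes r: "algebra_congruence (free_comm_algebra (carrier M)) r"
    and "sym_rel M \<subseteq> r" and sq: "\<And>i. i \<in> I \<Longrightarrow> (free_var (b i) * free_var (b i), 0) \<in> r"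
    and p: "p \<in> P" and q: "q \<in> P" and eq: "cls p = cls q"
  shows "(p, q) \<in> r"
proof -
  note rm = algebra_cong_module[OF r]
  note eqr = cong_equiv[OF rm] and eqs = cong_equiv[OF algebra_cong_module[OF sym_congruence]]
  have rP: "x \<in> P \<and> y \<in> P" if "(x, y) \<in> r" for x y
    using equiv_type[OF eqr] that by auto
  have trans: "(x, z) \<in> r" if "(x, y) \<in> r" "(y, z) \<in> r" for x y z
    using eqr that by (meson equivE transD)
  have sym: "(y, x) \<in> r" if "(x, y) \<in> r" for x y
    using eqr that by (meson equivE symD)
  have sr: "sym_cong M \<subseteq> r"
    unfolding sym_cong_def by (rule algebra_cong_gen_least) (use assms in auto)
  let ?c = "\<lambda>x. sym_cong M `` {x}"
  have c_in: "(x, y) \<in> r" if "?c x = ?c y" "x \<in> P" "y \<in> P" for x y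
    using that eq_equiv_class_iff[OF eqs] sr by auto
  \<comment> \<open>the relation induced by \<open>r\<close> on the symmetric algebra\<close>
  define t where "t = {(?c x, ?c y) | x y. (x, y) \<in> r}"
  have t_iff: "(?c x, ?c y) \<in> t \<longleftrightarrow> (x, y) \<in> r" if "x \<in> P" "y \<in> P" for x y
  proof
    assume "(?c x, ?c y) \<in> t"
    then obtain x' y' where "?c x = ?c x'" "?c y = ?c y'" "(x', y') \<in> r"
      unfolding t_def by blast
    with that rP[OF this(3)] c_in trans sym show "(x, y) \<in> r"
      by metis
  qed (auto simp: t_def)
  have tE: "\<exists>x y. X = ?c x \<and> Y = ?c y \<and> (x, y) \<in> r \<and> x \<in> P \<and> y \<in> P" if "(X, Y) \<in> t" for X Y
    using that rP unfolding t_def by blast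
  have "equiv (carrier (Sym M)) t"
  proof (intro equivI refl_onI symI transI)
    show "t \<subseteq> carrier (Sym M) \<times> carrier (Sym M)"
      using tE unfolding Sym_carrier by fast
    show "(X, X) \<in> t" if "X \<in> carrier (Sym M)" for X
      using that t_iff eqr unfolding Sym_carrier by (auto simp: equiv_def refl_on_def)
    show "(Y, X) \<in> t" if "(X, Y) \<in> t" for X Y
      using tE[OF that] sym unfolding t_def by blast
    show "(X, Z) \<in> t" if XY: "(X, Y) \<in> t" and YZ: "(Y, Z) \<in> t" for X Y Z
    proof -
      obtain x y where x: "X = ?c x" "Y = ?c y" "(x, y) \<in> r" "x \<in> P" "y \<in> P"
        using tE[OF XY] by blast
      obtain y' z where z: "Y = ?c y'" "Z = ?c z" "(y', z) \<in> r" "y' \<in> P" "z \<in> P"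
        using tE[OF YZ] by blast
      have "(y, y') \<in> r"
        using x z by (intro c_in) auto
      with x z show ?thesis
        using trans t_iff by metis
    qed
  qed
  moreover have "(X \<oplus>\<^bsub>Sym M\<^esub> Y, X' \<oplus>\<^bsub>Sym M\<^esub> Y') \<in> t \<and> (X \<otimes>\<^bsub>Sym M\<^esub> Y, X' \<otimes>\<^bsub>Sym M\<^esub> Y') \<in> t"
    if X: "(X, X') \<in> t" and Y: "(Y, Y') \<in> t" for X X' Y Y'
  proof -
    obtain x x' where x: "X = ?c x" "X' = ?c x'" "(x, x') \<in> r" "x \<in> P" "x' \<in> P"
      using tE[OF X] by blast
    obtain y y' where y: "Y = ?c y" "Y' = ?c y'" "(y, y') \<in> r" "y \<in> P" "y' \<in> P"
      using tE[OF Y] by blast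
    have "(x + y, x' + y') \<in> r" "(x * y, x' * y') \<in> r"
      using cong_add[OF rm x(3) y(3)] cong_mult[OF r x(3) y(3)] by simp_all
    with x y show ?thesis
      by (simp add: Sym_add Sym_mult t_iff polys_intros)
  qed
  moreover have "(a \<odot>\<^bsub>Sym M\<^esub> X, a \<odot>\<^bsub>Sym M\<^esub> X') \<in> t" if X: "(X, X') \<in> t" for a X X'
  proof -
    obtain x x' where x: "X = ?c x" "X' = ?c x'" "(x, x') \<in> r" "x \<in> P" "x' \<in> P"
      using tE[OF X] by blast
    have "(const a * x, const a * x') \<in> r"
      using cong_smult[OF rm x(3)] by simp
    with x show ?thesis
      by (simp add: Sym_smult t_iff polys_intros)
  qed
  ultimately have "algebra_congruence (Sym M) t"
    unfolding algebra_congruence_def module_congruence_def by blast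
  moreover have "(sym_incl M (b i) \<otimes>\<^bsub>Sym M\<^esub> sym_incl M (b i), \<zero>\<^bsub>Sym M\<^esub>) \<in> t" if "i \<in> I" for i
  proof -
    have "free_var (b i) \<in> P"
      using family that by (auto intro: polys_intros)
    then show ?thesis
      using sq[OF that] by (simp add: sym_incl_def Sym_mult Sym_zero t_iff polys_intros)
  qed
  ultimately have "ext_cong M I b \<subseteq> t"
    unfolding ext_cong_def by (intro algebra_cong_gen_least) auto
  moreover have "(?c p, ?c q) \<in> ext_cong M I b"
    using eq p q eq_equiv_class_iff[OF cong_equiv[OF algebra_cong_module[OF ext_congruence]]]
    unfolding grass_def by (simp add: Sym_carrier)
  ultimately show ?thesis
    using t_iff p q by blast
qed

lemma ext_comm_monoid: "comm_monoid (ext M I b)"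
  by (rule comm_monoidI) (auto simp: ext_carrier ext_mult ext_one polys_intros ac_simps)

lemma ext_deg_simps [simp]:
  "carrier (ext_deg M I b d) = cls ` forms (carrier M) d"
  "X \<oplus>\<^bsub>ext_deg M I b d\<^esub> Y = X \<oplus>\<^bsub>ext M I b\<^esub> Y"
  "a \<odot>\<^bsub>ext_deg M I b d\<^esub> X = a \<odot>\<^bsub>ext M I b\<^esub> X"
  "\<zero>\<^bsub>ext_deg M I b d\<^esub> = \<zero>\<^bsub>ext M I b\<^esub>"
  by (auto simp: ext_deg_def sym_deg_def grass_def forms_def polys_iff)

lemma ext_deg_abelian_monoid: "abelian_monoid (ext_deg M I b d)"
  by (rule abelian_monoidI)
    (auto simp: ext_zero ext_add forms_zero forms_add forms_subset_polys polys_add polys_zero ac_simps)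

lemma ext_finsum:
  assumes "\<And>i. i \<in> F \<Longrightarrow> g i \<in> forms (carrier M) d"
  shows "(\<Oplus>\<^bsub>ext_deg M I b d\<^esub>i\<in>F. cls (g i)) = cls (\<Sum>i\<in>F. g i)"
proof -
  interpret D: abelian_monoid "ext_deg M I b d"
    by (rule ext_deg_abelian_monoid)
  show ?thesis
    using assms
  proof (induction F rule: infinite_finite_induct)
    case (insert i F)
    have "(\<Oplus>\<^bsub>ext_deg M I b d\<^esub>i\<in>insert i F. cls (g i)) =
        cls (g i) \<oplus>\<^bsub>ext_deg M I b d\<^esub> (\<Oplus>\<^bsub>ext_deg M I b d\<^esub>i\<in>F. cls (g i))"
      using insert by (intro D.finsum_insert) auto
    also have "\<dots> = cls (g i + (\<Sum>i\<in>F. g i))"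
      using insert by (simp add: ext_add forms_subset_polys[where d = d] forms_sum)
    finally show ?case
      using insert by simp
  qed (auto simp: ext_zero)
qed

lemma ext_finprod:
  assumes "\<And>i. i \<in> F \<Longrightarrow> g i \<in> P"
  shows "(\<Otimes>\<^bsub>ext M I b\<^esub>i\<in>F. cls (g i)) = cls (\<Prod>i\<in>F. g i)"
proof -
  interpret D: comm_monoid "ext M I b"
    by (rule ext_comm_monoid)
  show ?thesis
    using assms
  proof (induction F rule: infinite_finite_induct)
    case (insert i F)
    have "(\<Otimes>\<^bsub>ext M I b\<^esub>i\<in>insert i F. cls (g i)) =
        cls (g i) \<otimes>\<^bsub>ext M I b\<^esub> (\<Otimes>\<^bsub>ext M I b\<^esub>i\<in>F. cls (g i))"
      using insert by (intro D.finprod_insert) (auto simp: ext_carrier)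
    also have "\<dots> = cls (g i * (\<Prod>i\<in>F. g i))"
      using insert by (simp add: ext_mult polys_prod)
    finally show ?case
      using insert by simp
  qed (auto simp: ext_one)
qed

definition monomial :: "'i set \<Rightarrow> ('m multiset \<Rightarrow>\<^sub>0 's)" where
  "monomial J = (\<Prod>j\<in>J. free_var (b j))"

abbreviation wedge_sum :: "nat \<Rightarrow> ('i set \<Rightarrow> 's) \<Rightarrow> ('m multiset \<Rightarrow>\<^sub>0 's)" where
  "wedge_sum d c \<equiv> (\<Sum>J\<in>subsets_of_card I d. const (c J) * monomial J)"

lemma wedge_eq: "J \<subseteq> I \<Longrightarrow> wedge M I b J = cls (monomial J)"
  unfolding wedge_def ext_incl_eq monomial_def
  using family by (intro ext_finprod) (auto intro!: polys_intros)

lemma monomial_forms: "J \<subseteq> I \<Longrightarrow> finite J \<Longrightarrow> monomial J \<in> forms (carrier M) (card J)"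
  unfolding monomial_def using family by (intro forms_prod_free_var) auto

lemma free_var_family: "i \<in> I \<Longrightarrow> free_var (b i) \<in> P"
  using family by (auto intro: polys_intros)

lemma cls_var_mult_monomial:
  assumes i: "i \<in> I" and J: "J \<subseteq> I" "finite J"
  shows "cls (free_var (b i) * monomial J) = (if i \<in> J then cls 0 else cls (monomial (insert i J)))"
proof (cases "i \<in> J")
  case True
  have "free_var (b i) * monomial J = (free_var (b i) * free_var (b i)) * monomial (J - {i})"
    using True J by (simp add: monomial_def prod.remove ac_simps)
  also have "cls \<dots> = cls (0 * monomial (J - {i}))"
    using i J free_var_family[OF i] cls_square[OF i]
    by (intro cls_mult_cong) (auto intro!: polys_intros forms_subset_polys[OF monomial_forms])
  finally show ?thesis
    using True by simp
next
  case False
  then show ?thesis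
    using J by (simp add: monomial_def)
qed

lemma ext_dual_iff:
  "\<psi> \<in> carrier (dual (ext_deg M I b d)) \<longleftrightarrow> \<psi> \<in> extensional (cls ` forms (carrier M) d) \<and>
    (\<forall>p\<in>forms (carrier M) d. \<forall>q\<in>forms (carrier M) d. \<psi> (cls (p + q)) = \<psi> (cls p) + \<psi> (cls q)) \<and>
    (\<forall>a. \<forall>p\<in>forms (carrier M) d. \<psi> (cls (const a * p)) = a * \<psi> (cls p))"
  by (auto simp: dual_def ext_add ext_smult forms_subset_polys)

lemma ext_dual_zero:
  assumes "\<psi> \<in> carrier (dual (ext_deg M I b d))"
  shows "\<psi> (cls 0) = 0"
proof -
  have "\<psi> (cls (const 0 * 0)) = 0 * \<psi> (cls 0)"
    using assms forms_zero unfolding ext_dual_iff by blast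
  then show ?thesis by simp
qed

lemma ext_dual_sum:
  assumes \<psi>: "\<psi> \<in> carrier (dual (ext_deg M I b d))"
    and "\<And>i. i \<in> F \<Longrightarrow> g i \<in> forms (carrier M) d"
  shows "\<psi> (cls (\<Sum>i\<in>F. const (c i) * g i)) = (\<Sum>i\<in>F. c i * \<psi> (cls (g i)))"
  using assms(2)
proof (induction F rule: infinite_finite_induct)
  case (insert i F)
  then have "\<psi> (cls (const (c i) * g i + (\<Sum>i\<in>F. const (c i) * g i))) =
      \<psi> (cls (const (c i) * g i)) + \<psi> (cls (\<Sum>i\<in>F. const (c i) * g i))"
    using \<psi> unfolding ext_dual_iff by (simp add: forms_sum forms_const_mult)
  also have "\<psi> (cls (const (c i) * g i)) = c i * \<psi> (cls (g i))"
    using \<psi> insert.prems unfolding ext_dual_iff by simp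
  finally show ?case
    using insert by simp
qed (auto simp: ext_dual_zero[OF \<psi>])

text \<open>
  The universal property by which functionals are constructed. The substitution \<open>L\<close> need not be
  linear; the requirement is that \<open>\<mu>\<close> cannot detect the difference, even after multiplication by an
  arbitrary polynomial \<open>u\<close>. This extra factor makes the relation \<open>r\<close> in the proof an algebra
  congruence, and it permits to check it on the generating relations only. The freedom to use a
  nonlinear \<open>L\<close> is needed for quotient modules, where \<open>L\<close> evaluates arbitrarily chosen
  representatives.
\<close>

lemma ext_dual_exists:
  fixes L :: "'m \<Rightarrow> ('k multiset \<Rightarrow>\<^sub>0 's)" and \<mu>
  assumes lam_add: "\<And>p q. \<mu> (p + q) = \<mu> p + \<mu> q" and lam_smult: "\<And>a p. \<mu> (const a * p) = a * \<mu> p"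
    and L_add: "\<And>u x y. x \<in> carrier M \<Longrightarrow> y \<in> carrier M \<Longrightarrow> \<mu> (u * L (x \<oplus> y)) = \<mu> (u * (L x + L y))"
    and L_smult: "\<And>u a x. x \<in> carrier M \<Longrightarrow> \<mu> (u * L (a \<odot> x)) = \<mu> (u * (const a * L x))"
    and L_square: "\<And>u i. i \<in> I \<Longrightarrow> \<mu> (u * (L (b i) * L (b i))) = 0"
  shows "\<exists>\<psi>\<in>carrier (dual (ext_deg M I b d)). \<forall>p\<in>forms (carrier M) d. \<psi> (cls p) = \<mu> (poly_subst L p)"
proof -
  let ?s = "poly_subst L"
  define r where "r = {(p, q) \<in> P \<times> P. \<forall>u. \<mu> (u * ?s p) = \<mu> (u * ?s q)}"
  have lam_zero: "\<mu> 0 = 0"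
    using lam_smult[of 0 0] by simp
  have eqr: "equiv P r"
    by (intro equivI refl_onI symI transI) (auto simp: r_def)
  have r: "algebra_congruence (free_comm_algebra (carrier M)) r"
    unfolding algebra_congruence_def module_congruence_def free_comm_algebra_simps
  proof (intro conjI allI impI eqr; (elim conjE)?)
    fix p p' q q' assume pq: "(p, p') \<in> r" "(q, q') \<in> r"
    then show "(p + q, p' + q') \<in> r"
      by (auto simp: r_def polys_intros poly_subst_add distrib_left lam_add)
    have "\<mu> (u * (?s p * ?s q)) = \<mu> (u * (?s p' * ?s q'))" for u
    proof -
      have "\<mu> ((u * ?s q) * ?s p) = \<mu> ((u * ?s q) * ?s p')"
        using pq(1) by (auto simp: r_def)
      also have "\<dots> = \<mu> ((u * ?s p') * ?s q)"
        by (simp add: ac_simps)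
      also have "\<dots> = \<mu> ((u * ?s p') * ?s q')"
        using pq(2) by (auto simp: r_def)
      finally show ?thesis
        by (simp add: ac_simps)
    qed
    then show "(p * q, p' * q') \<in> r"
      using pq by (auto simp: r_def polys_intros poly_subst_mult)
  next
    fix a p p' assume p: "(p, p') \<in> r"
    have "\<mu> (u * (const a * ?s p)) = \<mu> (u * (const a * ?s p'))" for u
    proof -
      have "\<mu> (u * const a * ?s p) = \<mu> (u * const a * ?s p')"
        using p unfolding r_def by blast
      then show ?thesis by (simp add: ac_simps)
    qed
    then show "(const a * p, const a * p') \<in> r"
      using p by (auto simp: r_def polys_intros poly_subst_const_mult)
  qed
  have "sym_rel M \<subseteq> r"
    using L_add L_smult
    by (auto simp: sym_rel_def r_def poly_subst_add poly_subst_const_mult poly_subst_free_var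
        intro!: polys_intros smult_closed)
  moreover have "(free_var (b i) * free_var (b i), 0) \<in> r" if "i \<in> I" for i
    using L_square[OF that] that
    by (auto simp: r_def poly_subst_mult poly_subst_free_var poly_subst_zero lam_zero
        intro!: polys_intros free_var_family)
  ultimately have inv: "\<mu> (?s p) = \<mu> (?s q)" if "p \<in> P" "q \<in> P" "cls p = cls q" for p q
    using cls_eqD[OF r, of p q] that unfolding r_def by (auto dest: spec[of _ 1])
  define \<psi> where "\<psi> = (\<lambda>X\<in>cls ` forms (carrier M) d.
    \<mu> (?s (SOME p. p \<in> forms (carrier M) d \<and> cls p = X)))"
  have \<psi>_cls: "\<psi> (cls p) = \<mu> (?s p)" if "p \<in> forms (carrier M) d" for p
  proof -
    let ?q = "SOME q. q \<in> forms (carrier M) d \<and> cls q = cls p"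
    have "?q \<in> forms (carrier M) d \<and> cls ?q = cls p"
      by (rule someI[of _ p]) (simp add: that)
    then have "\<mu> (?s ?q) = \<mu> (?s p)"
      using that by (intro inv) (auto intro: forms_subset_polys)
    then show ?thesis
      using that by (simp add: \<psi>_def)
  qed
  have "\<psi> \<in> carrier (dual (ext_deg M I b d))"
    unfolding ext_dual_iff
    by (auto simp: \<psi>_cls forms_add forms_const_mult poly_subst_add poly_subst_const_mult
        lam_add lam_smult) (simp add: \<psi>_def)
  with \<psi>_cls show ?thesis by blast
qed


section \<open>Spanning sets of exterior powers\<close>


lemma kernel_congruence:
  "algebra_congruence (free_comm_algebra (carrier M)) {(p, q) \<in> P \<times> P. cls p = cls q}" (is "algebra_congruence _ ?r")
  unfolding algebra_congruence_def module_congruence_def free_comm_algebra_simps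
proof (intro conjI allI impI; (elim conjE)?)
  show "equiv P ?r"
    by (intro equivI refl_onI symI transI) auto
  fix p p' q q' assume "(p, p') \<in> ?r" "(q, q') \<in> ?r"
  then show "(p + q, p' + q') \<in> ?r" "(p * q, p' * q') \<in> ?r"
    using cls_add_cong[of p p' q q'] cls_mult_cong[of p p' q q'] by (simp_all add: polys_intros)
next
  fix a p p' assume "(p, p') \<in> ?r"
  then show "(const a * p, const a * p') \<in> ?r"
    using cls_mult_cong[of "const a" "const a" p p'] by (simp add: polys_intros)
qed

lemma cls_finsum_var:
  assumes "v \<in> F \<rightarrow> carrier M"
  shows "cls (free_var (\<Oplus>i\<in>F. c i \<odot> v i)) = cls (\<Sum>i\<in>F. const (c i) * free_var (v i))"
  using assms
proof (induction F rule: infinite_finite_induct)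
  case (insert i F)
  have "cls (free_var (\<Oplus>i\<in>insert i F. c i \<odot> v i)) = cls (free_var (c i \<odot> v i \<oplus> (\<Oplus>i\<in>F. c i \<odot> v i)))"
    using insert by (subst finsum_insert) (auto intro: smult_closed)
  also have "\<dots> = cls (free_var (c i \<odot> v i) + free_var (\<Oplus>i\<in>F. c i \<odot> v i))"
    using insert by (intro cls_add_var) (auto intro!: smult_closed finsum_closed)
  also have "\<dots> = cls (const (c i) * free_var (v i) + (\<Sum>i\<in>F. const (c i) * free_var (v i)))"
    using insert by (intro cls_add_cong cls_smult_var) (auto intro!: smult_closed finsum_closed polys_intros)
  finally show ?case
    using insert by simp
qed (auto simp: cls_zero_var)

text \<open>
  If the family spans the module, the square-free monomials in the family span the exterior power:
  the set \<open>T d\<close> of forms of degree \<open>d\<close> with this property is closed under linear combinations, and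
  multiplication by a variable maps \<open>T d\<close> to \<open>T (Suc d)\<close> because, modulo the relations, the variable of
  an arbitrary element of the module is a combination of the variables of the family.
\<close>

lemma cls_forms_spanned:
  assumes fin: "finite I" and span: "\<And>x. x \<in> carrier M \<Longrightarrow> \<exists>c. x = (\<Oplus>i\<in>I. c i \<odot> b i)"
    and p: "p \<in> forms (carrier M) d"
  shows "\<exists>c. cls p = cls (wedge_sum d c)"
proof -
  define T where "T d = {p \<in> forms (carrier M) d.
    \<exists>c. cls p = cls (wedge_sum d c)}" for d
  have sub: "J \<subseteq> I \<and> finite J \<and> card J = d" if "J \<in> subsets_of_card I d" for J d
    using that fin by (auto simp: subsets_of_card_def intro: finite_subset)
  have finS: "finite (subsets_of_card I d)" for d
    using fin by (simp add: subsets_of_card_def)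
  have mon: "monomial J \<in> forms (carrier M) d" if "J \<in> subsets_of_card I d" for J d
    using monomial_forms sub[OF that] by auto
  have S: "wedge_sum d c \<in> forms (carrier M) d" for c d
    by (intro forms_sum forms_const_mult mon)
  note SP = forms_subset_polys[OF S]
  have Tforms: "p \<in> forms (carrier M) d" if "p \<in> T d" for p d
    using that by (simp add: T_def)
  have T_cong: "p \<in> T d" if "cls p = cls q" "p \<in> forms (carrier M) d" "q \<in> T d" for p q d
    using that by (simp add: T_def)
  have T_zero: "0 \<in> T d" for d
    unfolding T_def by (auto intro!: forms_zero exI[of _ "\<lambda>_. 0"])
  have T_add: "p + q \<in> T d" if pq: "p \<in> T d" "q \<in> T d" for p q d
  proof -
    obtain c where c: "cls p = cls (wedge_sum d c)"
      using pq(1) by (auto simp: T_def)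
    obtain c' where c': "cls q = cls (wedge_sum d c')"
      using pq(2) by (auto simp: T_def)
    have "cls (p + q) = cls (wedge_sum d c + wedge_sum d c')"
      using pq by (intro cls_add_cong c c' SP) (auto simp: forms_subset_polys[OF Tforms])
    also have "\<dots> = cls (wedge_sum d (\<lambda>J. c J + c' J))"
      by (simp add: const_add distrib_right sum.distrib)
    finally have "\<exists>c. cls (p + q) = cls (wedge_sum d c)"
      by (rule exI[of _ "\<lambda>J. c J + c' J"])
    with pq show ?thesis
      by (simp add: T_def forms_add)
  qed
  have T_smult: "const a * p \<in> T d" if p: "p \<in> T d" for a p d
  proof -
    obtain c where c: "cls p = cls (wedge_sum d c)"
      using p by (auto simp: T_def)
    have "cls (const a * p) = cls (const a * wedge_sum d c)"
      using p by (intro cls_mult_cong c SP) (auto simp: forms_subset_polys[OF Tforms] polys_const)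
    also have "\<dots> = cls (wedge_sum d (\<lambda>J. a * c J))"
      by (simp add: const_mult sum_distrib_left ac_simps)
    finally have "\<exists>c. cls (const a * p) = cls (wedge_sum d c)"
      by (rule exI[of _ "\<lambda>J. a * c J"])
    with p show ?thesis
      by (simp add: T_def forms_const_mult)
  qed
  have T_sum: "(\<Sum>i\<in>F. g i) \<in> T d" if "\<And>i. i \<in> F \<Longrightarrow> g i \<in> T d" for F :: "'x set" and g d
    using that by (induction F rule: infinite_finite_induct) (auto intro: T_zero T_add)
  have T_monomial: "monomial J \<in> T d" if J: "J \<in> subsets_of_card I d" for J d
  proof -
    have "wedge_sum d (\<lambda>K. if K = J then 1 else 0) = monomial J"
      using J finS by (simp add: if_distrib[of const] if_distrib[of "\<lambda>x. x * _"] sum.delta cong: if_cong)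
    then have "\<exists>c. cls (monomial J) = cls (wedge_sum d c)"
      by metis
    with mon[OF J] show ?thesis
      by (simp add: T_def)
  qed
  have T_gen: "free_var (b i) * monomial J \<in> T (Suc d)" if i: "i \<in> I" and J: "J \<in> subsets_of_card I d" for i J d
  proof (rule T_cong)
    show "cls (free_var (b i) * monomial J) = cls (if i \<in> J then 0 else monomial (insert i J))"
      using cls_var_mult_monomial[OF i] sub[OF J] by simp
    show "free_var (b i) * monomial J \<in> forms (carrier M) (Suc d)"
      using i family mon[OF J] by (auto intro!: forms_free_var_mult)
    show "(if i \<in> J then 0 else monomial (insert i J)) \<in> T (Suc d)"
      using i sub[OF J] by (auto intro!: T_zero T_monomial simp: subsets_of_card_def)
  qed
  have T_var: "free_var x * p \<in> T (Suc d)" if x: "x \<in> carrier M" and p: "p \<in> T d" for x p d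
  proof -
    obtain a where a: "x = (\<Oplus>i\<in>I. a i \<odot> b i)"
      using span[OF x] by blast
    obtain c where c: "cls p = cls (wedge_sum d c)"
      using p by (auto simp: T_def)
    have "cls (free_var x) = cls (\<Sum>i\<in>I. const (a i) * free_var (b i))"
      unfolding a by (rule cls_finsum_var) (rule family)
    then have eq: "cls (free_var x * p) =
        cls ((\<Sum>i\<in>I. const (a i) * free_var (b i)) * wedge_sum d c)"
      using x p c by (intro cls_mult_cong c SP)
        (auto simp: forms_subset_polys[OF Tforms] intro!: polys_intros free_var_family)
    have "(\<Sum>i\<in>I. \<Sum>J\<in>subsets_of_card I d. const (a i) * (const (c J) * (free_var (b i) * monomial J))) \<in> T (Suc d)"
      by (intro T_sum T_smult T_gen)
    also have "(\<Sum>i\<in>I. \<Sum>J\<in>subsets_of_card I d. const (a i) * (const (c J) * (free_var (b i) * monomial J))) =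
        (\<Sum>i\<in>I. const (a i) * free_var (b i)) * wedge_sum d c"
      unfolding sum_product by (intro sum.cong refl) (simp only: ac_simps)
    finally have "(\<Sum>i\<in>I. const (a i) * free_var (b i)) *
        wedge_sum d c \<in> T (Suc d)" .
    moreover have "free_var x * p \<in> forms (carrier M) (Suc d)"
      using x p by (intro forms_free_var_mult Tforms)
    ultimately show ?thesis
      using T_cong[OF eq] by blast
  qed
  have T_one: "1 \<in> T 0"
    using T_monomial[of "{}" 0] by (simp add: monomial_def subsets_of_card_def)
  have T_single: "Poly_Mapping.single m 1 \<in> T (size m)" if "set_mset m \<subseteq> carrier M" for m
    using that
  proof (induction m)
    case empty
    then show ?case using T_one by simp
  next
    case (add x m)
    then have "free_var x * Poly_Mapping.single m 1 \<in> T (Suc (size m))"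
      by (intro T_var) auto
    then show ?case
      by (simp add: free_var_def mult_single)
  qed
  have "(\<Sum>m\<in>Poly_Mapping.keys p. const (Poly_Mapping.lookup p m) * Poly_Mapping.single m 1) \<in> T d"
    using p by (intro T_sum T_smult) (use T_single in \<open>auto simp: forms_def\<close>)
  also have "(\<Sum>m\<in>Poly_Mapping.keys p. const (Poly_Mapping.lookup p m) * Poly_Mapping.single m 1) = p"
    using poly_eq_sum_monomials[of p] by (simp add: const_mult_single)
  finally show ?thesis
    by (simp add: T_def)
qed

end


section \<open>Functoriality\<close>

text \<open>
  A linear map which carries the family of \<open>M\<close> to the family of \<open>N\<close>. The relations of \<open>M\<close> are then
  mapped to relations of \<open>N\<close>, and since congruences can be pulled back along algebra
  homomorphisms, the map extends to Grassmann algebras.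
\<close>

locale presented_map = M: semimodule_family M I b + N: semimodule_family N I "\<lambda>i. f (b i)"
  for M :: "('s::idempotent_semifield, 'm) module" and N :: "('s, 'n) module"
    and I :: "'i set" and b :: "'i \<Rightarrow> 'm" and f :: "'m \<Rightarrow> 'n" +
  assumes f_closed: "f \<in> carrier M \<rightarrow> carrier N"
    and f_add: "x \<in> carrier M \<Longrightarrow> y \<in> carrier M \<Longrightarrow> f (x \<oplus>\<^bsub>M\<^esub> y) = f x \<oplus>\<^bsub>N\<^esub> f y"
    and f_smult: "x \<in> carrier M \<Longrightarrow> f (a \<odot>\<^bsub>M\<^esub> x) = a \<odot>\<^bsub>N\<^esub> f x"
begin

lemma free_map_polys: "p \<in> M.P \<Longrightarrow> free_map f p \<in> N.P"
  unfolding free_map_eq_poly_subst using f_closed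
  by (auto intro!: poly_subst_polys[where X = "carrier M"] polys_free_var)

lemma pullback_congruence:
  assumes r: "algebra_congruence (free_comm_algebra (carrier N)) r"
  shows "algebra_congruence (free_comm_algebra (carrier M)) {(p, q) \<in> M.P \<times> M.P. (free_map f p, free_map f q) \<in> r}"
proof -
  note rm = algebra_cong_module[OF r]
  note eqr = cong_equiv[OF rm]
  have "equiv M.P {(p, q) \<in> M.P \<times> M.P. (free_map f p, free_map f q) \<in> r}"
  proof (intro equivI refl_onI symI transI)
    show "(p, p) \<in> {(p, q) \<in> M.P \<times> M.P. (free_map f p, free_map f q) \<in> r}" if "p \<in> M.P" for p
      using that free_map_polys eqr by (auto simp: equiv_def refl_on_def)
  qed (use eqr in \<open>auto simp: equiv_def dest: symD transD\<close>)
  then show ?thesis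
    unfolding algebra_congruence_def module_congruence_def
    using cong_add[OF rm] cong_mult[OF r] cong_smult[OF rm]
    by (auto simp: free_map_eq_poly_subst poly_subst_add poly_subst_mult poly_subst_single polys_intros)
qed

lemma sym_rel_map:
  assumes "(p, q) \<in> sym_rel M"
  shows "(free_map f p, free_map f q) \<in> sym_rel N"
  using assms unfolding sym_rel_def
proof (elim UnE CollectE exE conjE)
  fix x y assume "(p, q) = (free_var (x \<oplus>\<^bsub>M\<^esub> y), free_var x + free_var y)" "x \<in> carrier M" "y \<in> carrier M"
  then have "(free_map f p, free_map f q) = (free_var (f x \<oplus>\<^bsub>N\<^esub> f y), free_var (f x) + free_var (f y))"
    "f x \<in> carrier N" "f y \<in> carrier N"
    using f_closed by (auto simp: free_map_eq_poly_subst poly_subst_add poly_subst_free_var f_add)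
  then show "(free_map f p, free_map f q) \<in> {(free_var (x \<oplus>\<^bsub>N\<^esub> y), free_var x + free_var y) |x y.
      x \<in> carrier N \<and> y \<in> carrier N} \<union> {(free_var (a \<odot>\<^bsub>N\<^esub> x), const a * free_var x) |a x. x \<in> carrier N}"
    by blast
next
  fix a x assume "(p, q) = (free_var (a \<odot>\<^bsub>M\<^esub> x), const a * free_var x)" "x \<in> carrier M"
  then have "(free_map f p, free_map f q) = (free_var (a \<odot>\<^bsub>N\<^esub> f x), const a * free_var (f x))"
    "f x \<in> carrier N"
    using f_closed by (auto simp: free_map_eq_poly_subst poly_subst_const_mult poly_subst_free_var f_smult)
  then show "(free_map f p, free_map f q) \<in> {(free_var (x \<oplus>\<^bsub>N\<^esub> y), free_var x + free_var y) |x y.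
      x \<in> carrier N \<and> y \<in> carrier N} \<union> {(free_var (a \<odot>\<^bsub>N\<^esub> x), const a * free_var x) |a x. x \<in> carrier N}"
    by blast
qed

lemma sym_cong_map:
  assumes "(p, q) \<in> sym_cong M"
  shows "(free_map f p, free_map f q) \<in> sym_cong N"
proof -
  have "sym_rel N \<subseteq> sym_cong N"
    unfolding sym_cong_def by (rule algebra_cong_gen_contains)
  moreover have "(free_map f p, free_map f q) \<in> sym_rel N" if "(p, q) \<in> sym_rel M" for p q
    using that by (rule sym_rel_map)
  ultimately have "sym_cong M \<subseteq> {(p, q) \<in> M.P \<times> M.P. (free_map f p, free_map f q) \<in> sym_cong N}"
    using M.sym_rel_closed unfolding sym_cong_def[of M]
    by (intro algebra_cong_gen_least pullback_congruence N.sym_congruence) blast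
  with assms show ?thesis by blast
qed

lemma cls_map:
  assumes "p \<in> M.P" "q \<in> M.P" "M.cls p = M.cls q"
  shows "N.cls (free_map f p) = N.cls (free_map f q)"
proof -
  let ?r = "{(p, q) \<in> N.P \<times> N.P. N.cls p = N.cls q}"
  note r = N.kernel_congruence
  have "(p, q) \<in> {(p, q) \<in> M.P \<times> M.P. (free_map f p, free_map f q) \<in> ?r}"
  proof (rule M.cls_eqD[OF pullback_congruence[OF r]])
    show "sym_rel M \<subseteq> {(p, q) \<in> M.P \<times> M.P. (free_map f p, free_map f q) \<in> ?r}"
      using M.sym_rel_closed N.cls_eq_of_sym_rel[OF sym_rel_map] free_map_polys by fast
    show "(free_var (b i) * free_var (b i), 0) \<in> {(p, q) \<in> M.P \<times> M.P. (free_map f p, free_map f q) \<in> ?r}"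
      if "i \<in> I" for i
      using that N.cls_square[OF that] M.free_var_family[OF that] N.free_var_family[OF that]
      by (simp add: free_map_eq_poly_subst poly_subst_mult poly_subst_free_var poly_subst_zero polys_intros)
  qed (use assms in auto)
  then show ?thesis by blast
qed

lemma ext_map_cls:
  assumes p: "p \<in> M.P"
  shows "ext_map N I (\<lambda>i. f (b i)) f (M.cls p) = N.cls (free_map f p)"
proof -
  note eqM = cong_equiv[OF algebra_cong_module[OF M.sym_congruence]]
    and eqN = cong_equiv[OF algebra_cong_module[OF N.sym_congruence]]
    and eqM' = cong_equiv[OF algebra_cong_module[OF M.ext_congruence]]
    and eqN' = cong_equiv[OF algebra_cong_module[OF N.ext_congruence]]
  have sym: "sym_map N f (sym_cong M `` {p}) = sym_cong N `` {free_map f p}" if "p \<in> M.P" for p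
    unfolding sym_map_def by (rule quot_map_class[OF eqM eqN]) (auto intro: that sym_cong_map)
  show ?thesis
    unfolding ext_map_def grass_def
  proof (subst quot_map_class[OF eqM' eqN'])
    show "sym_cong M `` {p} \<in> carrier (Sym M)"
      using p by (simp add: M.Sym_carrier)
    fix X Y assume XY: "(X, Y) \<in> ext_cong M I b"
    then have "X \<in> carrier (Sym M)" "Y \<in> carrier (Sym M)"
      using equiv_type[OF eqM'] by auto
    then obtain p q where pq: "p \<in> M.P" "X = sym_cong M `` {p}" "q \<in> M.P" "Y = sym_cong M `` {q}"
      by (auto simp: M.Sym_carrier)
    then have "M.cls p = M.cls q"
      using equiv_class_eq[OF eqM' XY] by (simp add: grass_def)
    then have "N.cls (free_map f p) = N.cls (free_map f q)"
      using cls_map pq by blast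
    then show "(sym_map N f X, sym_map N f Y) \<in> ext_cong N I (\<lambda>i. f (b i))"
      using pq eq_equiv_class_iff[OF eqN'] free_map_polys by (simp add: sym grass_def N.Sym_carrier)
  qed (simp add: sym p)
qed

lemma free_map_monomial: "free_map f (M.monomial J) = N.monomial J"
  unfolding M.monomial_def N.monomial_def free_map_eq_poly_subst poly_subst_prod poly_subst_free_var ..

text \<open>
  Every form over \<open>N\<close> lifts, variable by variable, to a form over \<open>M\<close>. Hence the dual of the map
  between exterior powers is injective when the given map is surjective.
\<close>

lemma free_map_surj:
  assumes surj: "carrier N \<subseteq> f ` carrier M" and p: "p \<in> forms (carrier N) k"
  obtains q where "q \<in> forms (carrier M) k" "free_map f q = p"
proof
  define g where "g = inv_into (carrier M) f"
  have g: "g y \<in> carrier M" "f (g y) = y" if "y \<in> carrier N" for y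
    using that surj by (auto simp: g_def inv_into_into f_inv_into_f subset_iff)
  show "free_map g p \<in> forms (carrier M) k"
    using p g(1) by (intro free_map_forms) auto
  have "image_mset f (image_mset g m) = m" if "m \<in> Poly_Mapping.keys p" for m
  proof -
    have "image_mset (\<lambda>y. f (g y)) m = image_mset (\<lambda>y. y) m"
      using that p by (intro image_mset_cong) (auto simp: forms_def g(2) subset_iff)
    then show ?thesis
      by (simp add: image_mset.compositionality comp_def)
  qed
  then have "free_map f (free_map g p) = (\<Sum>m\<in>Poly_Mapping.keys p. Poly_Mapping.single m (Poly_Mapping.lookup p m))"
    unfolding free_map_eq_poly_subst[of f] free_map_def[of g] poly_subst_sum
    by (intro sum.cong refl)
      (simp add: free_map_eq_poly_subst[symmetric] poly_subst_single free_var_def prod_single_variables mult_single)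
  then show "free_map f (free_map g p) = p"
    by (simp add: poly_eq_sum_monomials)
qed

end


section \<open>Free semimodules\<close>

locale free_semimodule = semimodule_family V I e
  for V :: "('s::idempotent_semifield, 'v) module" (structure) and I :: "'i set" and e :: "'i \<Rightarrow> 'v" +
  assumes basis: "is_basis V I e"
begin

lemma finite_index: "finite I"
  using basis by (simp add: is_basis_def)

abbreviation coord where "coord \<equiv> basis_coord V I e"

lemma coord_props:
  assumes "x \<in> carrier V"
  shows "coord x \<in> extensional I \<and> x = (\<Oplus>i\<in>I. coord x i \<odot> e i)"
proof -
  have "\<exists>!c. c \<in> extensional I \<and> x = (\<Oplus>i\<in>I. c i \<odot> e i)"
    using basis assms by (simp add: is_basis_def)
  from theI'[OF this] show ?thesis
    by (simp add: basis_coord_def)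
qed

lemma coord_unique:
  assumes "x = (\<Oplus>i\<in>I. c i \<odot> e i)" "i \<in> I"
  shows "coord x i = c i"
proof -
  have x: "x \<in> carrier V"
    unfolding assms using family by (auto intro!: finsum_closed smult_closed)
  have "(\<Oplus>i\<in>I. c i \<odot> e i) = (\<Oplus>i\<in>I. restrict c I i \<odot> e i)"
    using family by (intro finsum_cong') (auto intro!: smult_closed)
  then have "restrict c I \<in> extensional I \<and> x = (\<Oplus>i\<in>I. restrict c I i \<odot> e i)"
    using assms(1) by simp
  moreover have "\<exists>!c. c \<in> extensional I \<and> x = (\<Oplus>i\<in>I. c i \<odot> e i)"
    using basis x by (simp add: is_basis_def)
  ultimately have "coord x = restrict c I"
    unfolding basis_coord_def by (intro the1_equality)
  then show ?thesis
    using assms(2) by simp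
qed

lemma coord_add:
  assumes x: "x \<in> carrier V" and y: "y \<in> carrier V" and i: "i \<in> I"
  shows "coord (x \<oplus> y) i = coord x i + coord y i"
proof (rule coord_unique)
  have "x \<oplus> y = (\<Oplus>i\<in>I. coord x i \<odot> e i) \<oplus> (\<Oplus>i\<in>I. coord y i \<odot> e i)"
    using x y coord_props by metis
  also have "\<dots> = (\<Oplus>i\<in>I. coord x i \<odot> e i \<oplus> coord y i \<odot> e i)"
    using family by (intro finsum_addf[symmetric]) (auto intro!: smult_closed)
  also have "\<dots> = (\<Oplus>i\<in>I. (coord x i + coord y i) \<odot> e i)"
    using family by (intro finsum_cong') (auto intro!: smult_closed smult_l_distr[symmetric])
  finally show "x \<oplus> y = (\<Oplus>i\<in>I. (coord x i + coord y i) \<odot> e i)" .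
qed (fact i)

lemma coord_smult:
  assumes x: "x \<in> carrier V" and i: "i \<in> I"
  shows "coord (a \<odot> x) i = a * coord x i"
proof (rule coord_unique)
  have "a \<odot> x = a \<odot> (\<Oplus>i\<in>I. coord x i \<odot> e i)"
    using x coord_props by metis
  also have "\<dots> = (\<Oplus>i\<in>I. a \<odot> (coord x i \<odot> e i))"
    using family finite_index by (intro finsum_smult) (auto intro!: smult_closed)
  also have "\<dots> = (\<Oplus>i\<in>I. (a * coord x i) \<odot> e i)"
    using family by (intro finsum_cong') (auto intro!: smult_closed smult_assoc[symmetric])
  finally show "a \<odot> x = (\<Oplus>i\<in>I. (a * coord x i) \<odot> e i)" .
qed (fact i)

lemma coord_basis:
  assumes j: "j \<in> I" and i: "i \<in> I"
  shows "coord (e j) i = (if i = j then 1 else 0)"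
proof (rule coord_unique)
  have "(\<Oplus>i\<in>I. (if i = j then 1 else 0) \<odot> e i) = (\<Oplus>i\<in>I. if j = i then e i else \<zero>)"
    using family j by (intro finsum_cong') (auto simp: family_closed smult_one smult_l_null)
  also have "\<dots> = e j"
    using family j finite_index by (intro add.finprod_singleton) auto
  finally show "e j = (\<Oplus>i\<in>I. (if i = j then 1 else 0) \<odot> e i)" ..
qed (fact i)

lemma functional_eq_sum:
  assumes f: "f \<in> carrier (dual V)" and x: "x \<in> carrier V"
  shows "f x = (\<Sum>i\<in>I. coord x i * f (e i))"
proof -
  have "f x = f (\<Oplus>i\<in>I. coord x i \<odot> e i)"
    using x coord_props by metis
  then show ?thesis
    using functional_finsum[OF f family] by simp
qed

lemma functional_eqI:
  assumes "f \<in> carrier (dual V)" "g \<in> carrier (dual V)" "\<And>i. i \<in> I \<Longrightarrow> f (e i) = g (e i)"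
  shows "f = g"
proof (rule dual_eqI[where M = V])
  show "f x = g x" if "x \<in> carrier V" for x
    using assms that by (simp add: functional_eq_sum)
qed (use assms in \<open>auto simp: dual_simps\<close>)

text \<open>
  The definite description in \<open>dual_basis\<close> denotes the coordinate function because a functional is
  determined by its values on the basis.
\<close>

lemma dual_basis_eq:
  assumes i: "i \<in> I"
  shows "dual_basis V I e i = (\<lambda>x\<in>carrier V. coord x i)"
  unfolding dual_basis_def
proof (rule the_equality)
  have in_dual: "(\<lambda>x\<in>carrier V. coord x i) \<in> carrier (dual V)"
    using i by (intro dual_restrictI[OF semimodule_axioms]) (auto simp: coord_add coord_smult)
  then show *: "(\<lambda>x\<in>carrier V. coord x i) \<in> carrier (dual V) \<and>
      (\<forall>j\<in>I. (\<lambda>x\<in>carrier V. coord x i) (e j) = (if j = i then 1 else 0))"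
    using family i by (auto simp: coord_basis)
  show "f = (\<lambda>x\<in>carrier V. coord x i)"
    if "f \<in> carrier (dual V) \<and> (\<forall>j\<in>I. f (e j) = (if j = i then 1 else 0))" for f
    using that * by (intro functional_eqI) auto
qed

lemma dual_basis_closed: "dual_basis V I e \<in> I \<rightarrow> carrier (dual V)"
  by (auto simp: dual_basis_eq coord_add coord_smult intro!: dual_restrictI[OF semimodule_axioms])

lemma dual_basis_apply: "i \<in> I \<Longrightarrow> j \<in> I \<Longrightarrow> dual_basis V I e i (e j) = (if j = i then 1 else 0)"
  using family by (auto simp: dual_basis_eq coord_basis)

lemma dual_finsum_basis:
  assumes "F \<subseteq> I"
  shows "(\<Oplus>\<^bsub>dual V\<^esub>i\<in>F. a i \<odot>\<^bsub>dual V\<^esub> dual_basis V I e i) \<in> carrier (dual V)"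
    and "j \<in> I \<Longrightarrow> (\<Oplus>\<^bsub>dual V\<^esub>i\<in>F. a i \<odot>\<^bsub>dual V\<^esub> dual_basis V I e i) (e j) = (if j \<in> F then a j else 0)"
proof -
  interpret D: semimodule "dual V"
    by (rule semimodule_dual) unfold_locales
  have closed: "(\<lambda>i. a i \<odot>\<^bsub>dual V\<^esub> dual_basis V I e i) \<in> F \<rightarrow> carrier (dual V)"
    using assms dual_basis_closed by (auto intro!: D.smult_closed)
  then show "(\<Oplus>\<^bsub>dual V\<^esub>i\<in>F. a i \<odot>\<^bsub>dual V\<^esub> dual_basis V I e i) \<in> carrier (dual V)"
    by (rule D.finsum_closed)
  assume j: "j \<in> I"
  have "(\<Sum>i\<in>F. (a i \<odot>\<^bsub>dual V\<^esub> dual_basis V I e i) (e j)) = (\<Sum>i\<in>F. if j = i then a i else 0)"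
    using assms j family by (intro sum.cong) (auto simp: dual_simps(4) dual_basis_apply)
  also have "\<dots> = (if j \<in> F then a j else 0)"
    using finite_subset[OF assms finite_index] by simp
  finally show "(\<Oplus>\<^bsub>dual V\<^esub>i\<in>F. a i \<odot>\<^bsub>dual V\<^esub> dual_basis V I e i) (e j) = (if j \<in> F then a j else 0)"
    using j family by (subst dual_finsum[OF semimodule_axioms closed]) auto
qed

lemma dual_expansion:
  "f \<in> carrier (dual V) \<Longrightarrow> f = (\<Oplus>\<^bsub>dual V\<^esub>i\<in>I. f (e i) \<odot>\<^bsub>dual V\<^esub> dual_basis V I e i)"
  using dual_finsum_basis[where F = I and a = "\<lambda>i. f (e i)"] by (intro functional_eqI) auto

text \<open>
  Coordinate vectors as linear polynomials in variables that are indexed by the basis. In this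
  polynomial algebra the coefficients of square-free monomials can be read off.
\<close>

definition vector_form :: "('i \<Rightarrow> 's) \<Rightarrow> ('i multiset \<Rightarrow>\<^sub>0 's)" where
  "vector_form a = (\<Sum>i\<in>I. const (a i) * free_var i)"

lemma vector_form_add: "(\<And>i. i \<in> I \<Longrightarrow> c i = a i + a' i) \<Longrightarrow> vector_form c = vector_form a + vector_form a'"
  unfolding vector_form_def by (simp add: const_add distrib_right sum.distrib)

lemma vector_form_smult: "(\<And>i. i \<in> I \<Longrightarrow> c i = s * a i) \<Longrightarrow> vector_form c = const s * vector_form a"
  unfolding vector_form_def by (simp add: const_mult sum_distrib_left mult.assoc)

lemma vector_form_unit: "j \<in> I \<Longrightarrow> (\<And>i. i \<in> I \<Longrightarrow> c i = (if i = j then 1 else 0)) \<Longrightarrow> vector_form c = free_var j"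
proof -
  assume j: "j \<in> I" and c: "\<And>i. i \<in> I \<Longrightarrow> c i = (if i = j then 1 else 0)"
  have "vector_form c = (\<Sum>i\<in>I. if j = i then free_var i else 0)"
    unfolding vector_form_def using c by (intro sum.cong) auto
  then show ?thesis
    using j finite_index by simp
qed

text \<open>
  The coefficient of \<open>\<Prod>\<^sub>j X\<^sub>j\<close>, where \<open>j\<close> ranges over \<open>J\<close>, after substitution of coordinates for
  vectors.
\<close>

lemma coordinate_functional:
  assumes "J \<subseteq> I"
  obtains \<psi> where "\<psi> \<in> carrier (dual (ext_deg V I e d))"
    and "\<And>K. K \<in> subsets_of_card I d \<Longrightarrow> \<psi> (cls (monomial K)) = (if K = J then 1 else 0)"
proof -
  define \<mu> where "\<mu> p = Poly_Mapping.lookup p (mset_set J)" for p :: "'i multiset \<Rightarrow>\<^sub>0 's"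
  define L where "L x = vector_form (coord x)" for x
  have L_basis: "L (e i) = free_var i" if "i \<in> I" for i
    unfolding L_def using that by (intro vector_form_unit) (auto simp: coord_basis)
  have "\<exists>\<psi>\<in>carrier (dual (ext_deg V I e d)). \<forall>p\<in>forms (carrier V) d. \<psi> (cls p) = \<mu> (poly_subst L p)"
  proof (rule ext_dual_exists)
    show "\<mu> (p + q) = \<mu> p + \<mu> q" "\<mu> (const a * p) = a * \<mu> p" for a p q
      by (simp_all add: \<mu>_def lookup_add lookup_const_mult)
    show "\<mu> (u * L (x \<oplus> y)) = \<mu> (u * (L x + L y))" if "x \<in> carrier V" "y \<in> carrier V" for u x y
      using that vector_form_add[of "coord (x \<oplus> y)" "coord x" "coord y"] by (simp add: L_def coord_add)
    show "\<mu> (u * L (a \<odot> x)) = \<mu> (u * (const a * L x))" if "x \<in> carrier V" for u a x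
      using that vector_form_smult[of "coord (a \<odot> x)" a "coord x"] by (simp add: L_def coord_smult)
    show "\<mu> (u * (L (e i) * L (e i))) = 0" if "i \<in> I" for u i
      using that by (simp add: L_basis \<mu>_def lookup_mult_square[OF count_mset_set_le_one])
  qed
  then obtain \<psi> where \<psi>: "\<psi> \<in> carrier (dual (ext_deg V I e d))"
    and ev: "\<And>p. p \<in> forms (carrier V) d \<Longrightarrow> \<psi> (cls p) = \<mu> (poly_subst L p)"
    by blast
  show ?thesis
  proof
    fix K assume "K \<in> subsets_of_card I d"
    then have K: "K \<subseteq> I" "card K = d" "finite K"
      using finite_index by (auto simp: subsets_of_card_def intro: finite_subset)
    have "poly_subst L (monomial K) = (\<Prod>j\<in>K. free_var j)"
      unfolding monomial_def poly_subst_prod poly_subst_free_var using K by (intro prod.cong) (auto simp: L_basis)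
    then have "\<psi> (cls (monomial K)) = \<mu> (Poly_Mapping.single (mset_set K) 1)"
      using ev[of "monomial K"] monomial_forms[of K] K by (simp add: prod_variables)
    then show "\<psi> (cls (monomial K)) = (if K = J then 1 else 0)"
      using K finite_subset[OF assms finite_index]
      by (simp add: \<mu>_def lookup_single when_def mset_set_eq_iff)
  qed (fact \<psi>)
qed

lemma finite_subsets_of_card: "finite (subsets_of_card I d)"
  using finite_index by (simp add: subsets_of_card_def)

lemma subsets_of_cardD: "J \<in> subsets_of_card I d \<Longrightarrow> J \<subseteq> I \<and> finite J \<and> card J = d"
  using finite_index by (auto simp: subsets_of_card_def intro: finite_subset)

lemma monomial_in_forms: "J \<in> subsets_of_card I d \<Longrightarrow> monomial J \<in> forms (carrier V) d"
  using monomial_forms subsets_of_cardD by auto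

lemma monomial_sum_in_forms: "wedge_sum d c \<in> forms (carrier V) d"
  by (intro forms_sum forms_const_mult monomial_in_forms)

lemma ext_finsum_wedge:
  "(\<Oplus>\<^bsub>ext_deg V I e d\<^esub>J\<in>subsets_of_card I d. c J \<odot>\<^bsub>ext_deg V I e d\<^esub> wedge V I e J) =
     cls (wedge_sum d c)"
proof -
  interpret D: abelian_monoid "ext_deg V I e d"
    by (rule ext_deg_abelian_monoid)
  have "(\<Oplus>\<^bsub>ext_deg V I e d\<^esub>J\<in>subsets_of_card I d. c J \<odot>\<^bsub>ext_deg V I e d\<^esub> wedge V I e J) =
      (\<Oplus>\<^bsub>ext_deg V I e d\<^esub>J\<in>subsets_of_card I d. cls (const (c J) * monomial J))"
    using subsets_of_cardD
    by (intro D.finsum_cong')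
      (auto simp: wedge_eq ext_smult forms_subset_polys[OF monomial_in_forms] intro!: forms_const_mult monomial_in_forms)
  then show ?thesis
    by (simp add: ext_finsum forms_const_mult monomial_in_forms)
qed

lemma cls_monomial_sum_inject:
  assumes "cls (wedge_sum d c) =
      cls (wedge_sum d c')"
    and J: "J \<in> subsets_of_card I d"
  shows "c J = c' J"
proof -
  obtain \<psi> where \<psi>: "\<psi> \<in> carrier (dual (ext_deg V I e d))"
    and ev: "\<And>K. K \<in> subsets_of_card I d \<Longrightarrow> \<psi> (cls (monomial K)) = (if K = J then 1 else 0)"
    using coordinate_functional subsets_of_cardD[OF J] by metis
  have "\<psi> (cls (wedge_sum d c)) = c J" for c
  proof -
    have "\<psi> (cls (wedge_sum d c)) =
        (\<Sum>K\<in>subsets_of_card I d. c K * \<psi> (cls (monomial K)))"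
      by (rule ext_dual_sum[OF \<psi> monomial_in_forms])
    also have "\<dots> = (\<Sum>K\<in>subsets_of_card I d. if J = K then c K else 0)"
      by (intro sum.cong) (auto simp: ev)
    finally show ?thesis
      using J by (simp add: finite_subsets_of_card)
  qed
  from this[of c] this[of c'] assms(1) show ?thesis
    by (simp only:)
qed

lemma ext_is_basis: "is_basis (ext_deg V I e d) (subsets_of_card I d) (wedge V I e)"
  unfolding is_basis_def
proof (intro conjI ballI finite_subsets_of_card)
  show "wedge V I e \<in> subsets_of_card I d \<rightarrow> carrier (ext_deg V I e d)"
    using subsets_of_cardD by (auto simp: wedge_eq monomial_in_forms)
  fix x assume "x \<in> carrier (ext_deg V I e d)"
  then obtain p where p: "p \<in> forms (carrier V) d" "x = cls p"
    by auto
  have "\<exists>c. y = (\<Oplus>i\<in>I. c i \<odot> e i)" if "y \<in> carrier V" for y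
    using coord_props that by blast
  from cls_forms_spanned[OF finite_index this p(1)]
  obtain c where c: "x = cls (wedge_sum d c)"
    using p by auto
  show "\<exists>!c. c \<in> extensional (subsets_of_card I d) \<and>
      x = (\<Oplus>\<^bsub>ext_deg V I e d\<^esub>J\<in>subsets_of_card I d. c J \<odot>\<^bsub>ext_deg V I e d\<^esub> wedge V I e J)"
    unfolding ext_finsum_wedge
  proof (intro ex1I conjI)
    show "restrict c (subsets_of_card I d) \<in> extensional (subsets_of_card I d)"
      by simp
    show "x = cls (wedge_sum d (\<lambda>J. restrict c (subsets_of_card I d) J))"
      using c by simp
    fix c'
    assume c': "c' \<in> extensional (subsets_of_card I d) \<and>
        x = cls (wedge_sum d c')"
    have "c' J = c J" if "J \<in> subsets_of_card I d" for J
      using c' c that by (intro cls_monomial_sum_inject[where d = d]) simp_all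
    with c' show "c' = restrict c (subsets_of_card I d)"
      by (intro extensionalityI[of _ "subsets_of_card I d"]) simp_all
  qed
qed

lemma basis_coord_ext:
  assumes "x \<in> carrier (ext_deg V I e d)"
  shows "x = cls (wedge_sum d (\<lambda>J. basis_coord (ext_deg V I e d) (subsets_of_card I d) (wedge V I e) x J))"
  (is "x = cls (\<Sum>J\<in>_. const (?c J) * _)")
proof -
  have "\<exists>!c. c \<in> extensional (subsets_of_card I d) \<and>
      x = (\<Oplus>\<^bsub>ext_deg V I e d\<^esub>J\<in>subsets_of_card I d. c J \<odot>\<^bsub>ext_deg V I e d\<^esub> wedge V I e J)"
    using ext_is_basis assms by (simp only: is_basis_def)
  from theI'[OF this, folded basis_coord_def] show ?thesis
    unfolding ext_finsum_wedge by (rule conjunct2)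
qed

end


section \<open>Vectors incident to a tropical Pluecker vector\<close>

lemma semifield_mult_left_cancel:
  fixes a b c :: "'s::idempotent_semifield"
  assumes "c \<noteq> 0" "c * a = c * b"
  shows "a = b"
proof -
  obtain k where "c * k = 1"
    using ex_mult_inverse[OF assms(1)] by blast
  then have k: "k * (c * t) = t" for t
    by (simp add: mult.assoc[symmetric] mult.commute[of k c])
  show ?thesis
    using arg_cong[OF assms(2), of "\<lambda>t. k * t"] unfolding k .
qed

lemma semifield_mult_nonzero:
  fixes a b :: "'s::idempotent_semifield"
  shows "a \<noteq> 0 \<Longrightarrow> b \<noteq> 0 \<Longrightarrow> a * b \<noteq> 0"
  using semifield_mult_left_cancel[of a b 0] by auto

lemma semifield_add_eq_0:
  fixes a b :: "'s::idempotent_semifield"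
  assumes "a + b = 0"
  shows "a = 0"
proof -
  have "a = a + (a + b)"
    by (simp add: assms)
  also have "\<dots> = a + b"
    by (simp add: add.assoc[symmetric] add_idempotent)
  finally show ?thesis
    by (simp add: assms)
qed

text \<open>
  The tropical Pluecker relations between two vectors; \<open>u\<close> is a tropical Pluecker vector if
  it is nonzero and incident to itself.
\<close>

definition incident :: "'i set \<Rightarrow> nat \<Rightarrow> ('i set \<Rightarrow> 's::idempotent_semifield) \<Rightarrow> ('i set \<Rightarrow> 's) \<Rightarrow> bool" where
  "incident I d u z \<longleftrightarrow> (\<forall>A B p. A \<subseteq> I \<and> card A = d + 1 \<and> B \<subseteq> I \<and> card B + 1 = d \<and> p \<in> A - B \<longrightarrow>
     (\<Sum>i\<in>A - B. u (A - {i}) * z (insert i B)) = (\<Sum>i\<in>A - B - {p}. u (A - {i}) * z (insert i B)))"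

lemma incidentD:
  "incident I d u z \<Longrightarrow> A \<subseteq> I \<Longrightarrow> card A = d + 1 \<Longrightarrow> B \<subseteq> I \<Longrightarrow> card B + 1 = d \<Longrightarrow> p \<in> A - B \<Longrightarrow>
     (\<Sum>i\<in>A - B. u (A - {i}) * z (insert i B)) = (\<Sum>i\<in>A - B - {p}. u (A - {i}) * z (insert i B))"
  unfolding incident_def by blast

lemma incident_smult:
  assumes "incident I d u z"
  shows "incident I d u (\<lambda>J. a * z J)"
proof -
  have *: "(\<Sum>i\<in>T. u (A - {i}) * (a * z (insert i B))) = a * (\<Sum>i\<in>T. u (A - {i}) * z (insert i B))" for T A B
    by (simp add: sum_distrib_left mult.left_commute)
  show ?thesis
    unfolding incident_def *
    by (intro allI impI arg_cong[where f = "times a"] incidentD[OF assms]) auto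
qed

text \<open>
  For \<open>A = B + i + j\<close> the sum has two terms. Dropping either of them does not change the sum, so both
  are equal to it.
\<close>

lemma incident_adjacent:
  assumes inc: "incident I d u z" and I: "finite I"
    and B: "B \<subseteq> I" "card B + 1 = d" and ij: "i \<in> I - B" "j \<in> I - B" "i \<noteq> j"
  shows "u (insert j B) * z (insert i B) = u (insert i B) * z (insert j B)"
proof -
  have fin: "finite B"
    using B I finite_subset by auto
  let ?A = "insert i (insert j B)"
  have A: "?A \<subseteq> I" "card ?A = d + 1" "?A - B = {i, j}" "?A - B - {i} = {j}" "?A - B - {j} = {i}"
    "?A - {i} = insert j B" "?A - {j} = insert i B"
    using B ij fin by auto
  have "(\<Sum>k\<in>?A - B. u (?A - {k}) * z (insert k B)) = u (insert j B) * z (insert i B)"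
    using incidentD[OF inc A(1,2) B, of j] A(5,6) ij by simp
  moreover have "(\<Sum>k\<in>?A - B. u (?A - {k}) * z (insert k B)) = u (insert i B) * z (insert j B)"
    using incidentD[OF inc A(1,2) B, of i] A(4,7) ij by simp
  ultimately show ?thesis by simp
qed

text \<open>
  Induction on the distance from \<open>J\<close> to \<open>K\<close>. If \<open>u\<close> and \<open>y\<close> both vanish at \<open>K\<close>, both sides are zero.
  Otherwise let \<open>z\<close> be one of them which does not vanish at \<open>K\<close>, and let \<open>k \<in> K - J\<close>. In the relation
  between \<open>u\<close> and \<open>z\<close> for \<open>A = J + k\<close> and \<open>B = K - k\<close> the term with index \<open>k\<close> is \<open>u J * z K\<close>, which is
  nonzero. In an idempotent semifield the sum is then nonzero, and it is still nonzero without this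
  term. So there is some \<open>i \<in> J - K\<close> such that \<open>u\<close> does not vanish at \<open>J' = J + k - i\<close>. This set is
  closer to \<open>K\<close>, and it is adjacent to \<open>J\<close>.
\<close>

lemma incident_proportional:
  assumes uu: "incident I d u u" and uy: "incident I d u y" and I: "finite I"
    and J: "J \<in> subsets_of_card I d" "u J \<noteq> 0" and K: "K \<in> subsets_of_card I d"
  shows "u J * y K = u K * y J"
  using J
proof (induction "card (J - K)" arbitrary: J rule: less_induct)
  case less
  have fin: "finite J" "finite K" and sub: "J \<subseteq> I" "K \<subseteq> I" and card: "card J = d" "card K = d"
    using less.prems K I by (auto simp: subsets_of_card_def intro: finite_subset)
  show ?case
  proof (cases "J = K \<or> (u K = 0 \<and> y K = 0)")
    case True
    then show ?thesis by (auto simp: mult.commute)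
  next
    case False
    then obtain z where z: "z K \<noteq> 0" and uz: "incident I d u z"
      using uu uy by blast
    have "\<not> K \<subseteq> J"
      using False fin card card_subset_eq by metis
    then obtain k where k: "k \<in> K" "k \<notin> J"
      by blast
    \<comment> \<open>exchange \<open>k\<close> against some \<open>i\<close>, using the relation in which \<open>u J * z K\<close> is a term\<close>
    let ?A = "insert k J" and ?B = "K - {k}"
    have A: "?A \<subseteq> I" "card ?A = d + 1"
      using k fin sub card by auto
    have "card K = Suc (card ?B)"
      by (rule card.remove[OF fin(2) k(1)])
    with sub card have B: "?B \<subseteq> I" "card ?B + 1 = d"
      by auto
    have kAB: "k \<in> ?A - ?B" and finAB: "finite (?A - ?B)"
      using fin by auto
    have Ak: "?A - {k} = J" and Bk: "insert k ?B = K"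
      using k by auto
    let ?t = "\<lambda>i. u (?A - {i}) * z (insert i ?B)"
    have split: "sum ?t (?A - ?B) = u J * z K + sum ?t (?A - ?B - {k})"
      using sum.remove[OF finAB kAB, of ?t] unfolding Ak Bk .
    have "u J * z K \<noteq> 0"
      using less.prems(2) z by (rule semifield_mult_nonzero)
    then have "sum ?t (?A - ?B) \<noteq> 0"
      unfolding split using semifield_add_eq_0 by blast
    then have "sum ?t (?A - ?B - {k}) \<noteq> 0"
      unfolding incidentD[OF uz A B kAB] .
    then obtain i where i: "i \<in> ?A - ?B - {k}" "u (?A - {i}) * z (insert i ?B) \<noteq> 0"
      by (meson sum.not_neutral_contains_not_neutral)
    then have iJ: "i \<in> J" "i \<notin> K" "i \<noteq> k" and ui: "u (?A - {i}) \<noteq> 0"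
      by auto
    let ?J' = "insert k (J - {i})"
    have J'_eq: "?A - {i} = ?J'"
      using iJ by auto
    have J': "?J' \<in> subsets_of_card I d" "u ?J' \<noteq> 0"
      using A fin sub card iJ k ui unfolding J'_eq[symmetric] by (auto simp: subsets_of_card_def)
    have "?J' - K = (J - K) - {i}"
      using k by auto
    then have "card (?J' - K) < card (J - K)"
      using iJ fin by (metis DiffI card_Diff1_less finite_Diff)
    from less.hyps[OF this J'] have IH: "u ?J' * y K = u K * y ?J'" .
    have "card (J - {i}) + 1 = d"
      using iJ fin card by (metis Suc_eq_plus1 card.remove)
    then have "u (insert k (J - {i})) * y (insert i (J - {i})) = u (insert i (J - {i})) * y (insert k (J - {i}))"
      using sub iJ k K by (intro incident_adjacent[OF uy I]) auto
    then have adj: "u ?J' * y J = u J * y ?J'"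
      using iJ by (simp add: insert_absorb)
    have "u ?J' * (u J * y K) = u J * (u K * y ?J')"
      unfolding IH[symmetric] by (simp add: ac_simps)
    also have "\<dots> = u K * (u ?J' * y J)"
      unfolding adj by (simp add: ac_simps)
    also have "\<dots> = u ?J' * (u K * y J)"
      by (simp add: ac_simps)
    finally show ?thesis
      using J'(2) semifield_mult_left_cancel by blast
  qed
qed


section \<open>The exterior power of the quotient module of a tropical Pluecker vector\<close>

text \<open>
  Otherwise the simplifier rewrites the index set \<open>{1..n}\<close> to \<open>{Suc 0..n}\<close>, and the facts about
  \<open>{1..n}\<close> do not match any more.
\<close>

declare One_nat_def [simp del]

locale pluecker_vector = free_semimodule V "{1..n}" e
  for V :: "('s::idempotent_semifield, 'v) module" (structure) and n :: nat and e :: "nat \<Rightarrow> 'v" +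
  fixes d :: nat and w :: "('v multiset \<Rightarrow>\<^sub>0 's) set set"
  assumes pluecker: "tropical_pluecker V n e d w"
begin

abbreviation S where "S \<equiv> subsets_of_card {1..n}"

abbreviation c where "c \<equiv> pluecker_coord V n e d w"

definition w_form :: "'v multiset \<Rightarrow>\<^sub>0 's" where
  "w_form = wedge_sum d c"

lemma w_form_in_forms: "w_form \<in> forms (carrier V) d"
  unfolding w_form_def by (rule monomial_sum_in_forms)

lemma w_eq: "w = cls w_form"
  unfolding w_form_def pluecker_coord_def
  by (rule basis_coord_ext) (use pluecker in \<open>simp add: tropical_pluecker_def\<close>)

lemma pluecker_incident: "incident {1..n} d c c"
  using pluecker unfolding tropical_pluecker_def incident_def Let_def by auto

lemma ex_nonzero_coord: "\<exists>J\<in>S d. c J \<noteq> 0"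
proof (rule ccontr)
  assume "\<not> (\<exists>J\<in>S d. c J \<noteq> 0)"
  then have "w_form = 0"
    by (simp add: w_form_def)
  then have "w = \<zero>\<^bsub>ext_pow V n e d\<^esub>"
    using w_eq by (simp add: ext_zero)
  with pluecker show False
    by (simp add: tropical_pluecker_def)
qed

lemma smult_w: "a \<odot>\<^bsub>ext_pow V n e d\<^esub> w = cls (wedge_sum d (\<lambda>J. a * c J))"
proof -
  have "const a * w_form = wedge_sum d (\<lambda>J. a * c J)"
    by (simp add: w_form_def const_mult sum_distrib_left mult.assoc)
  then show ?thesis
    using ext_smult[OF forms_subset_polys[OF w_form_in_forms], of a] by (simp add: w_eq[symmetric])
qed

lemma inj_smult_w: "inj (\<lambda>a. a \<odot>\<^bsub>ext_pow V n e d\<^esub> w)"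
proof (rule injI)
  fix a a' assume eq: "a \<odot>\<^bsub>ext_pow V n e d\<^esub> w = a' \<odot>\<^bsub>ext_pow V n e d\<^esub> w"
  obtain J where J: "J \<in> S d" "c J \<noteq> 0"
    using ex_nonzero_coord by blast
  have "a * c J = a' * c J"
    using eq J(1) unfolding smult_w by (rule cls_monomial_sum_inject)
  then show "a = a'"
    using J(2) semifield_mult_left_cancel[of "c J" a a'] by (simp add: mult.commute)
qed

abbreviation bend_forms where
  "bend_forms \<equiv> dual_map V (wedge_with V n e w) ` carrier (dual (ext_pow V n e (d + 1)))"

lemma wedge_with_eq: "v \<in> carrier V \<Longrightarrow> wedge_with V n e w v = cls (free_var v * w_form)"
  using ext_mult[OF polys_free_var forms_subset_polys[OF w_form_in_forms], of v]
  by (simp add: wedge_with_def ext_incl_eq w_eq[symmetric])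

lemma bend_form_closed:
  assumes \<theta>: "\<theta> \<in> carrier (dual (ext_pow V n e (d + 1)))"
  shows "dual_map V (wedge_with V n e w) \<theta> \<in> carrier (dual V)"
  unfolding dual_map_def
proof (rule dual_restrictI[OF semimodule_axioms])
  note W = forms_subset_polys[OF w_form_in_forms]
  have form: "free_var v * w_form \<in> forms (carrier V) (d + 1)" if "v \<in> carrier V" for v
    using forms_free_var_mult[OF that w_form_in_forms] by (simp add: Suc_eq_plus1)
  fix x y a assume x: "x \<in> carrier V"
  show "\<theta> (wedge_with V n e w (a \<odot> x)) = a * \<theta> (wedge_with V n e w x)"
  proof -
    have "cls (free_var (a \<odot> x) * w_form) = cls (const a * free_var x * w_form)"
      using x W by (intro cls_mult_cong cls_smult_var) (auto intro!: polys_intros smult_closed)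
    then show ?thesis
      using \<theta> x form[OF x] unfolding ext_dual_iff by (simp add: wedge_with_eq smult_closed mult.assoc)
  qed
  assume y: "y \<in> carrier V"
  show "\<theta> (wedge_with V n e w (x \<oplus> y)) = \<theta> (wedge_with V n e w x) + \<theta> (wedge_with V n e w y)"
  proof -
    have "cls (free_var (x \<oplus> y) * w_form) = cls ((free_var x + free_var y) * w_form)"
      using x y W by (intro cls_mult_cong cls_add_var) (auto intro!: polys_intros)
    then show ?thesis
      using \<theta> x y form[OF x] form[OF y] unfolding ext_dual_iff by (simp add: wedge_with_eq distrib_right)
  qed
qed

text \<open>
  Collecting the terms of \<open>e\<^sub>i \<and> w\<close> by the index sets \<open>A = J + i\<close> exhibits the dual image of \<open>\<theta>\<close> as
  the combination of the forms \<open>f\<^sub>A\<close> with coefficients \<open>\<theta> e\<^sub>A\<close>.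
\<close>

lemma bend_form_coeff:
  assumes \<theta>: "\<theta> \<in> carrier (dual (ext_pow V n e (d + 1)))" and i: "i \<in> {1..n}"
  shows "dual_map V (wedge_with V n e w) \<theta> (e i) =
    (\<Sum>A\<in>S (d + 1). if i \<in> A then c (A - {i}) * \<theta> (cls (monomial A)) else 0)"
proof -
  have ei: "e i \<in> carrier V"
    using i by (rule family_closed)
  have "free_var (e i) * w_form = (\<Sum>J\<in>S d. const (c J) * (free_var (e i) * monomial J))"
    unfolding w_form_def sum_distrib_left by (intro sum.cong refl mult.left_commute)
  then have "dual_map V (wedge_with V n e w) \<theta> (e i) =
      \<theta> (cls (\<Sum>J\<in>S d. const (c J) * (free_var (e i) * monomial J)))"
    using ei by (simp add: dual_map_def wedge_with_eq)
  also have "\<dots> = (\<Sum>J\<in>S d. c J * \<theta> (cls (free_var (e i) * monomial J)))"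
    using forms_free_var_mult[OF ei monomial_in_forms] by (intro ext_dual_sum[OF \<theta>]) (simp add: Suc_eq_plus1)
  also have "\<dots> = (\<Sum>J\<in>S d. if i \<in> J then 0 else c J * \<theta> (cls (monomial (insert i J))))"
    using i subsets_of_cardD ext_dual_zero[OF \<theta>] by (intro sum.cong) (auto simp: cls_var_mult_monomial)
  also have "\<dots> = (\<Sum>J\<in>{J \<in> S d. i \<notin> J}. c J * \<theta> (cls (monomial (insert i J))))"
    using finite_subsets_of_card by (intro sum.mono_neutral_cong_right) auto
  also have "\<dots> = (\<Sum>A\<in>{A \<in> S (d + 1). i \<in> A}. c (A - {i}) * \<theta> (cls (monomial A)))"
    using i subsets_of_cardD
    by (intro sum.reindex_bij_witness[of _ "\<lambda>A. A - {i}" "insert i"])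
      (auto simp: subsets_of_card_def insert_absorb card_insert_if card_Diff_singleton finite_subset)
  also have "\<dots> = (\<Sum>A\<in>S (d + 1). if i \<in> A then c (A - {i}) * \<theta> (cls (monomial A)) else 0)"
    using finite_subsets_of_card by (intro sum.mono_neutral_cong_left) auto
  finally show ?thesis .
qed

text \<open>
  Applied to the product of \<open>x\<^sub>B\<close> and a bend relation of \<open>f\<close>, a functional with values \<open>z\<close> yields the two
  sides. They are linear in \<open>f\<close>, so it is enough to compare them for \<open>f\<^sub>A\<close>, where this is the incidence
  relation for \<open>A\<close> and \<open>B\<close>.
\<close>

lemma bend_form_orthogonal:
  assumes f: "f \<in> bend_forms" and z: "incident {1..n} d c z" and B: "B \<subseteq> {1..n}" "card B + 1 = d"
  shows "(\<Sum>i\<in>{1..n}. f (e i) * (if i \<in> B then 0 else z (insert i B))) =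
    (\<Sum>i\<in>{1..n} - {j}. f (e i) * (if i \<in> B then 0 else z (insert i B)))"
proof -
  obtain \<theta> where \<theta>: "\<theta> \<in> carrier (dual (ext_pow V n e (d + 1)))" "f = dual_map V (wedge_with V n e w) \<theta>"
    using f by blast
  have *: "(\<Sum>i\<in>T. f (e i) * (if i \<in> B then 0 else z (insert i B))) =
      (\<Sum>A\<in>S (d + 1). \<theta> (cls (monomial A)) * (\<Sum>i\<in>T \<inter> (A - B). c (A - {i}) * z (insert i B)))"
    if "T \<subseteq> {1..n}" for T
  proof -
    have T: "finite T"
      using that finite_subset by blast
    have "(\<Sum>i\<in>T. f (e i) * (if i \<in> B then 0 else z (insert i B))) =
        (\<Sum>i\<in>T. \<Sum>A\<in>S (d + 1). if i \<in> A - B then \<theta> (cls (monomial A)) * (c (A - {i}) * z (insert i B)) else 0)"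
    proof (intro sum.cong refl)
      fix i assume "i \<in> T"
      then have "f (e i) = (\<Sum>A\<in>S (d + 1). if i \<in> A then c (A - {i}) * \<theta> (cls (monomial A)) else 0)"
        unfolding \<theta>(2) using that by (intro bend_form_coeff[OF \<theta>(1)]) auto
      then show "f (e i) * (if i \<in> B then 0 else z (insert i B)) =
          (\<Sum>A\<in>S (d + 1). if i \<in> A - B then \<theta> (cls (monomial A)) * (c (A - {i}) * z (insert i B)) else 0)"
        by (auto simp: sum_distrib_right mult.assoc mult.left_commute intro!: sum.cong)
    qed
    also have "\<dots> = (\<Sum>A\<in>S (d + 1). \<Sum>i\<in>T. if i \<in> A - B then \<theta> (cls (monomial A)) * (c (A - {i}) * z (insert i B)) else 0)"
      by (rule sum.swap)
    also have "\<dots> = (\<Sum>A\<in>S (d + 1). \<Sum>i\<in>T \<inter> (A - B). \<theta> (cls (monomial A)) * (c (A - {i}) * z (insert i B)))"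
      using T by (intro sum.cong refl sum.inter_restrict[symmetric])
    finally show ?thesis
      by (simp add: sum_distrib_left)
  qed
  have "(\<Sum>i\<in>{1..n} \<inter> (A - B). c (A - {i}) * z (insert i B)) =
      (\<Sum>i\<in>({1..n} - {j}) \<inter> (A - B). c (A - {i}) * z (insert i B))" if "A \<in> S (d + 1)" for A
  proof -
    have A: "A \<subseteq> {1..n}" "card A = d + 1"
      using that by (auto simp: subsets_of_card_def)
    then have eq: "{1..n} \<inter> (A - B) = A - B" "({1..n} - {j}) \<inter> (A - B) = A - B - {j}"
      by auto
    show ?thesis
      using incidentD[OF z A B, of j] unfolding eq by (cases "j \<in> A - B") auto
  qed
  then show ?thesis
    by (simp add: *)
qed

abbreviation x where "x \<equiv> dual_vec V n e"

abbreviation Q where "Q \<equiv> Q_mod V n e d w"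

abbreviation proj where "proj \<equiv> Q_proj V n e d w"

lemma dual_semimodule: "semimodule (dual V)"
  by (rule semimodule_dual[OF semimodule_axioms])

lemma bend_rel_closed: "(\<Union>f\<in>bend_forms. bend_rel V n e f) \<subseteq> carrier (dual V) \<times> carrier (dual V)"
  unfolding bend_rel_def using bend_form_closed dual_finsum_basis(1) by fastforce

lemma Q_congruence: "module_congruence (dual V) (Q_cong V n e d w)"
  unfolding Q_cong_def bend_cong_def
  by (intro module_congruence_gen semimodule_closed dual_semimodule bend_rel_closed)

lemma Q_carrier: "carrier Q = proj ` carrier (dual V)"
  by (simp add: Q_mod_def quot_carrier Q_proj_def)

lemma Q_semimodule: "semimodule Q"
  unfolding Q_mod_def by (intro semimodule_quot dual_semimodule Q_congruence)

lemma proj_eq_iff: "f \<in> carrier (dual V) \<Longrightarrow> g \<in> carrier (dual V) \<Longrightarrow> proj f = proj g \<longleftrightarrow> (f, g) \<in> Q_cong V n e d w"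
  unfolding Q_proj_def by (rule cong_class_eq_iff[OF Q_congruence])

lemma proj_add: "f \<in> carrier (dual V) \<Longrightarrow> g \<in> carrier (dual V) \<Longrightarrow> proj (f \<oplus>\<^bsub>dual V\<^esub> g) = proj f \<oplus>\<^bsub>Q\<^esub> proj g"
  unfolding Q_proj_def Q_mod_def by (rule quot_add[OF Q_congruence, symmetric])

lemma proj_smult: "f \<in> carrier (dual V) \<Longrightarrow> proj (a \<odot>\<^bsub>dual V\<^esub> f) = a \<odot>\<^bsub>Q\<^esub> proj f"
  unfolding Q_proj_def Q_mod_def by (rule quot_smult[OF Q_congruence, symmetric])

lemma proj_presented: "presented_map (dual V) Q {1..n} x proj"
proof -
  interpret D: semimodule "dual V" by (rule dual_semimodule)
  interpret Q: semimodule Q by (rule Q_semimodule)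
  show ?thesis
    by unfold_locales
      (use dual_basis_closed in \<open>auto simp: Q_carrier proj_add proj_smult Pi_iff\<close>)
qed

end

sublocale pluecker_vector \<subseteq> pr: presented_map "dual V" "Q_mod V n e d w" "{1..n}" "dual_vec V n e" "Q_proj V n e d w"
  by (rule proj_presented)

context pluecker_vector
begin

lemma bend_relation_in_Q:
  assumes f: "f \<in> bend_forms" and j: "j \<in> {1..n}"
  shows "proj f = proj (\<Oplus>\<^bsub>dual V\<^esub>i\<in>{1..n} - {j}. f (e i) \<odot>\<^bsub>dual V\<^esub> x i)" (is "_ = proj ?f'")
proof -
  have "(f, ?f') \<in> bend_rel V n e f"
    unfolding bend_rel_def using j by (intro CollectI exI[of _ j] conjI refl)
  then have rel: "(f, ?f') \<in> (\<Union>f\<in>bend_forms. bend_rel V n e f)"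
    by (rule UN_I[OF f])
  then have "(f, ?f') \<in> Q_cong V n e d w"
    unfolding Q_cong_def bend_cong_def by (rule subsetD[OF module_cong_gen_contains])
  moreover have "f \<in> carrier (dual V)" "?f' \<in> carrier (dual V)"
    using subsetD[OF bend_rel_closed rel] by simp_all
  ultimately show ?thesis
    by (simp only: proj_eq_iff)
qed

text \<open>
  The expansion of a linear form in the dual basis holds in the Grassmann algebra of the dual of \<open>V\<close>,
  and \<open>Q\<^sub>w\<close> inherits it by functoriality.
\<close>

lemma cls_var_proj:
  assumes f: "f \<in> carrier (dual V)"
  shows "pr.N.cls (free_var (proj f)) = pr.N.cls (\<Sum>i\<in>{1..n}. const (f (e i)) * free_var (proj (x i)))"
proof -
  have "pr.M.cls (free_var (\<Oplus>\<^bsub>dual V\<^esub>i\<in>{1..n}. f (e i) \<odot>\<^bsub>dual V\<^esub> x i)) =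
      pr.M.cls (\<Sum>i\<in>{1..n}. const (f (e i)) * free_var (x i))"
    by (rule pr.M.cls_finsum_var[OF pr.M.family])
  then have "pr.M.cls (free_var f) = pr.M.cls (\<Sum>i\<in>{1..n}. const (f (e i)) * free_var (x i))"
    using dual_expansion[OF f] by simp
  from pr.cls_map[OF polys_free_var[OF f] _ this] show ?thesis
    unfolding free_map_eq_poly_subst poly_subst_sum poly_subst_const_mult poly_subst_free_var
    by (auto intro: polys_intros pr.M.free_var_family)
qed

text \<open>
  For given \<open>A\<close>, the coordinate functional \<open>\<theta>\<close> of \<open>e\<^sub>A\<close> makes \<open>f\<^sub>A\<close> the dual image of \<open>\<theta>\<close>. Its bend
  relation at \<open>p\<close> holds in \<open>Q\<^sub>w\<close>; multiplying it by \<open>x\<^sub>B\<close> and applying \<open>\<psi>\<close> gives the incidence relation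
  for \<open>A\<close>, \<open>B\<close> and \<open>p\<close>.
\<close>

lemma functional_values_incident:
  assumes \<psi>: "\<psi> \<in> carrier (dual (Q_ext_pow V n e d w))"
  shows "incident {1..n} d c (\<lambda>J. \<psi> (pr.N.cls (pr.N.monomial J)))" (is "incident _ _ _ ?y")
  unfolding incident_def
proof (intro allI impI, elim conjE)
  fix A B p
  assume A: "A \<subseteq> {1..n}" "card A = d + 1" and B: "B \<subseteq> {1..n}" "card B + 1 = d" and p: "p \<in> A - B"
  have finB: "finite B"
    using B finite_subset by blast
  obtain \<theta> where \<theta>: "\<theta> \<in> carrier (dual (ext_pow V n e (d + 1)))"
    and \<theta>_mon: "\<And>K. K \<in> S (d + 1) \<Longrightarrow> \<theta> (cls (monomial K)) = (if K = A then 1 else 0)"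
    using coordinate_functional[OF A(1)] by metis
  define f where "f = dual_map V (wedge_with V n e w) \<theta>"
  have f: "f \<in> bend_forms" "f \<in> carrier (dual V)"
    using \<theta> bend_form_closed by (auto simp: f_def)
  have f_coeff: "f (e i) = (if i \<in> A then c (A - {i}) else 0)" if "i \<in> {1..n}" for i
  proof -
    have "f (e i) = (\<Sum>K\<in>S (d + 1). if A = K then (if i \<in> A then c (A - {i}) else 0) else 0)"
      unfolding f_def bend_form_coeff[OF \<theta> that] by (intro sum.cong refl) (auto simp: \<theta>_mon)
    then show ?thesis
      using A finite_subsets_of_card by (simp add: subsets_of_card_def)
  qed
  have eval: "\<psi> (pr.N.cls (free_var (proj g) * pr.N.monomial B)) =
      (\<Sum>i\<in>{1..n}. g (e i) * (if i \<in> B then 0 else ?y (insert i B)))" if g: "g \<in> carrier (dual V)" for g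
  proof -
    have mon: "pr.N.monomial B \<in> forms (carrier Q) (card B)"
      using B(1) finB by (rule pr.N.monomial_forms)
    have var_P: "free_var (proj g) \<in> pr.N.P"
      using g by (auto simp: Q_carrier intro!: polys_free_var)
    have sum_P: "(\<Sum>i\<in>{1..n}. const (g (e i)) * free_var (proj (x i))) \<in> pr.N.P"
      by (intro polys_sum polys_mult polys_const pr.N.free_var_family)
    note mon_P = forms_subset_polys[OF mon]
    have "pr.N.cls (free_var (proj g) * pr.N.monomial B) =
        pr.N.cls ((\<Sum>i\<in>{1..n}. const (g (e i)) * free_var (proj (x i))) * pr.N.monomial B)"
      by (rule pr.N.cls_mult_cong[OF var_P sum_P mon_P mon_P cls_var_proj[OF g] refl])
    also have "(\<Sum>i\<in>{1..n}. const (g (e i)) * free_var (proj (x i))) * pr.N.monomial B =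
        (\<Sum>i\<in>{1..n}. const (g (e i)) * (free_var (proj (x i)) * pr.N.monomial B))"
      by (simp add: sum_distrib_right mult.assoc)
    finally have "\<psi> (pr.N.cls (free_var (proj g) * pr.N.monomial B)) =
        \<psi> (pr.N.cls (\<Sum>i\<in>{1..n}. const (g (e i)) * (free_var (proj (x i)) * pr.N.monomial B)))"
      by (simp only:)
    also have "\<dots> = (\<Sum>i\<in>{1..n}. g (e i) * \<psi> (pr.N.cls (free_var (proj (x i)) * pr.N.monomial B)))"
    proof (rule pr.N.ext_dual_sum[OF \<psi>])
      fix i assume "i \<in> {1..n}"
      then show "free_var (proj (x i)) * pr.N.monomial B \<in> forms (carrier Q) d"
        using forms_free_var_mult[OF pr.N.family_closed mon] B(2) by (simp add: Suc_eq_plus1)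
    qed
    also have "\<dots> = (\<Sum>i\<in>{1..n}. g (e i) * (if i \<in> B then 0 else ?y (insert i B)))"
    proof (intro sum.cong refl arg_cong2[where f = times])
      fix i assume "i \<in> {1..n}"
      then show "\<psi> (pr.N.cls (free_var (proj (x i)) * pr.N.monomial B)) = (if i \<in> B then 0 else ?y (insert i B))"
        using pr.N.cls_var_mult_monomial[OF _ B(1) finB, of i] pr.N.ext_dual_zero[OF \<psi>] by simp
    qed
    finally show ?thesis .
  qed
  let ?f' = "\<Oplus>\<^bsub>dual V\<^esub>i\<in>{1..n} - {p}. f (e i) \<odot>\<^bsub>dual V\<^esub> x i"
  have f': "?f' \<in> carrier (dual V)" "i \<in> {1..n} \<Longrightarrow> ?f' (e i) = (if i = p then 0 else f (e i))" for i
    using dual_finsum_basis[of "{1..n} - {p}"] by auto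
  have "proj f = proj ?f'"
    using f A p by (intro bend_relation_in_Q) auto
  then have eq: "(\<Sum>i\<in>{1..n}. f (e i) * (if i \<in> B then 0 else ?y (insert i B))) =
      (\<Sum>i\<in>{1..n}. ?f' (e i) * (if i \<in> B then 0 else ?y (insert i B)))"
    using eval[OF f(2)] eval[OF f'(1)] by simp
  have "(\<Sum>i\<in>A - B. c (A - {i}) * ?y (insert i B)) = (\<Sum>i\<in>{1..n}. f (e i) * (if i \<in> B then 0 else ?y (insert i B)))"
    using A by (intro sum.mono_neutral_cong_left) (auto simp: f_coeff)
  also have "\<dots> = (\<Sum>i\<in>{1..n}. ?f' (e i) * (if i \<in> B then 0 else ?y (insert i B)))"
    by (rule eq)
  also have "\<dots> = (\<Sum>i\<in>A - B - {p}. c (A - {i}) * ?y (insert i B))"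
    using A by (intro sum.mono_neutral_cong_right) (auto simp: f_coeff f'(2))
  finally show "(\<Sum>i\<in>A - B. c (A - {i}) * ?y (insert i B)) = (\<Sum>i\<in>A - B - {p}. c (A - {i}) * ?y (insert i B))" .
qed

text \<open>
  The vector \<open>a w\<close> as a functional on polynomials in coordinates \<open>X\<^sub>1, \<dots>, X\<^sub>n\<close>. The functional on the
  exterior power of \<open>Q\<^sub>w\<close> which corresponds to \<open>a w\<close> is induced by it.
\<close>

definition pairing :: "'s \<Rightarrow> (nat multiset \<Rightarrow>\<^sub>0 's) \<Rightarrow> 's" where
  "pairing a p = (\<Sum>J\<in>S d. a * c J * Poly_Mapping.lookup p (mset_set J))"

lemma pairing_add: "pairing a (p + q) = pairing a p + pairing a q"
  by (simp add: pairing_def lookup_add distrib_left sum.distrib)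

lemma pairing_smult: "pairing a (const s * p) = s * pairing a p"
  unfolding pairing_def lookup_const_mult sum_distrib_left by (simp only: ac_simps)

lemma pairing_zero: "pairing a 0 = 0"
  by (simp add: pairing_def)

lemma pairing_sum: "pairing a (\<Sum>i\<in>F. const (s i) * g i) = (\<Sum>i\<in>F. s i * pairing a (g i))"
  by (induction F rule: infinite_finite_induct) (auto simp: pairing_zero pairing_add pairing_smult)

lemma pairing_square: "pairing a (u * (free_var i * free_var i)) = 0"
  by (simp add: pairing_def lookup_mult_square[OF count_mset_set_le_one])

lemma pairing_monomial: "J \<in> S d \<Longrightarrow> pairing a (Poly_Mapping.single (mset_set J) 1) = a * c J"
proof -
  assume J: "J \<in> S d"
  have "pairing a (Poly_Mapping.single (mset_set J) 1) = (\<Sum>K\<in>S d. if J = K then a * c K else 0)"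
    unfolding pairing_def using J subsets_of_cardD
    by (intro sum.cong refl) (auto simp: lookup_single when_def mset_set_eq_iff)
  then show ?thesis
    using J finite_subsets_of_card by simp
qed

text \<open>
  The product of a monomial \<open>m\<close> and a variable can only be square-free of degree \<open>d\<close> if \<open>m\<close> is
  square-free of degree \<open>d - 1\<close>, that is, if it belongs to a set \<open>B\<close> as in the Pluecker relations.
\<close>

lemma pairing_variable:
  obtains "\<And>i. i \<in> {1..n} \<Longrightarrow> pairing a (Poly_Mapping.single m s * free_var i) = 0"
  | B where "B \<subseteq> {1..n}" "card B + 1 = d"
    "\<And>i. i \<in> {1..n} \<Longrightarrow> pairing a (Poly_Mapping.single m s * free_var i) = s * (if i \<in> B then 0 else a * c (insert i B))"
proof (cases "\<exists>B. B \<subseteq> {1..n} \<and> card B + 1 = d \<and> m = mset_set B")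
  case True
  then obtain B where B: "B \<subseteq> {1..n}" "card B + 1 = d" "m = mset_set B"
    by blast
  then have finB: "finite B"
    using finite_subset by blast
  have "pairing a (Poly_Mapping.single m s * free_var i) = s * (if i \<in> B then 0 else a * c (insert i B))"
    if i: "i \<in> {1..n}" for i
  proof -
    have "Poly_Mapping.single m s * free_var i = const s * Poly_Mapping.single (add_mset i m) 1"
      by (simp add: free_var_def mult_single)
    moreover have "pairing a (Poly_Mapping.single (add_mset i m) 1) = (if i \<in> B then 0 else a * c (insert i B))"
    proof (cases "i \<in> B")
      case True
      then have "count (add_mset i m) i = 2"
        using B(3) finB by simp
      then have "add_mset i m \<noteq> mset_set J" for J
        using count_mset_set_le_one[of J i] by fastforce
      then show ?thesis
        using True by (simp add: pairing_def lookup_single when_def)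
    next
      case False
      then have "add_mset i m = mset_set (insert i B)" "insert i B \<in> S d"
        using B i finB by (auto simp: subsets_of_card_def)
      then show ?thesis
        using False pairing_monomial by simp
    qed
    ultimately show ?thesis
      by (simp add: pairing_smult)
  qed
  with B show ?thesis
    using that(2) by blast
next
  case False
  have "pairing a (Poly_Mapping.single m s * free_var i) = 0" if i: "i \<in> {1..n}" for i
  proof -
    have "add_mset i m \<noteq> mset_set J" if J: "J \<in> S d" for J
    proof
      assume eq: "add_mset i m = mset_set J"
      have J': "J \<subseteq> {1..n}" "finite J" "card J = d"
        using subsets_of_cardD[OF J] by auto
      have "i \<in># mset_set J"
        unfolding eq[symmetric] by simp
      then have iJ: "i \<in> J"
        using J' by simp
      have "mset_set J = add_mset i (mset_set (J - {i}))"
        using iJ J' by (simp add: mset_set.remove)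
      then have "m = mset_set (J - {i})"
        using eq by simp
      moreover have "card (J - {i}) + 1 = d"
        using iJ J' by (metis Suc_eq_plus1 card.remove)
      ultimately show False
        using \<open>\<not> (\<exists>B. _ B)\<close> J' by blast
    qed
    then show ?thesis
      by (simp add: pairing_def free_var_def mult_single lookup_single when_def)
  qed
  then show ?thesis
    by (rule that(1))
qed

definition lin :: "('v \<Rightarrow> 's) \<Rightarrow> (nat multiset \<Rightarrow>\<^sub>0 's)" where
  "lin f = vector_form (\<lambda>i. f (e i))"

lemma lin_add: "lin (f \<oplus>\<^bsub>dual V\<^esub> g) = lin f + lin g"
  unfolding lin_def by (intro vector_form_add) (simp add: dual_simps(3) family_closed)

lemma lin_smult: "lin (a \<odot>\<^bsub>dual V\<^esub> f) = const a * lin f"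
  unfolding lin_def by (intro vector_form_smult) (simp add: dual_simps(4) family_closed)

lemma lin_basis: "i \<in> {1..n} \<Longrightarrow> lin (x i) = free_var i"
  unfolding lin_def by (intro vector_form_unit) (auto simp: dual_basis_apply)

text \<open>
  It suffices to take a monomial for \<open>u\<close>. If the pairing does not vanish on all multiples of it by
  variables, it is \<open>X\<^sub>B\<close> up to a factor, and the claim is orthogonality of \<open>f\<close> to the vector \<open>a w\<close>,
  which is incident to \<open>w\<close> because \<open>w\<close> is.
\<close>

lemma pairing_bend:
  assumes f: "f \<in> bend_forms"
  shows "pairing a (u * lin f) = pairing a (u * lin (\<Oplus>\<^bsub>dual V\<^esub>i\<in>{1..n} - {j}. f (e i) \<odot>\<^bsub>dual V\<^esub> x i))"
    (is "_ = pairing a (u * lin ?f')")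
proof -
  have lin_f': "lin ?f' = (\<Sum>i\<in>{1..n} - {j}. const (f (e i)) * free_var i)"
    unfolding lin_def vector_form_def
    by (intro sum.mono_neutral_cong_right) (auto simp: dual_finsum_basis(2))
  have lin_f: "lin f = (\<Sum>i\<in>{1..n}. const (f (e i)) * free_var i)"
    by (simp add: lin_def vector_form_def)
  have inc: "incident {1..n} d c (\<lambda>J. a * c J)"
    by (rule incident_smult[OF pluecker_incident])
  have step: "pairing a (Poly_Mapping.single m s * lin f) = pairing a (Poly_Mapping.single m s * lin ?f')" for m s
  proof -
    have eval: "pairing a (Poly_Mapping.single m s * (\<Sum>i\<in>T. const (f (e i)) * free_var i)) =
        (\<Sum>i\<in>T. f (e i) * pairing a (Poly_Mapping.single m s * free_var i))" for T
    proof -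
      have "Poly_Mapping.single m s * (\<Sum>i\<in>T. const (f (e i)) * free_var i) =
          (\<Sum>i\<in>T. const (f (e i)) * (Poly_Mapping.single m s * free_var i))"
        by (simp add: sum_distrib_left mult.left_commute)
      then show ?thesis
        by (simp only: pairing_sum)
    qed
    show ?thesis
      unfolding lin_f lin_f' eval
    proof (cases rule: pairing_variable[of a m s])
      case 1
      then show "(\<Sum>i\<in>{1..n}. f (e i) * pairing a (Poly_Mapping.single m s * free_var i)) =
          (\<Sum>i\<in>{1..n} - {j}. f (e i) * pairing a (Poly_Mapping.single m s * free_var i))"
        by simp
    next
      case (2 B)
      have "(\<Sum>i\<in>T. f (e i) * pairing a (Poly_Mapping.single m s * free_var i)) =
          s * (\<Sum>i\<in>T. f (e i) * (if i \<in> B then 0 else a * c (insert i B)))" if "T \<subseteq> {1..n}" for T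
        unfolding sum_distrib_left using that 2(3) by (intro sum.cong refl) (auto simp: mult.left_commute)
      then show "(\<Sum>i\<in>{1..n}. f (e i) * pairing a (Poly_Mapping.single m s * free_var i)) =
          (\<Sum>i\<in>{1..n} - {j}. f (e i) * pairing a (Poly_Mapping.single m s * free_var i))"
        using bend_form_orthogonal[OF f inc 2(1,2), of j] by simp
    qed
  qed
  show ?thesis
  proof (induction u rule: poly_induct)
    case zero
    show ?case by simp
  next
    case (add m q)
    then show ?case
      by (simp add: distrib_right pairing_add step)
  qed
qed

lemma pairing_Q_cong:
  assumes "(f, f') \<in> Q_cong V n e d w"
  shows "pairing a (u * lin f) = pairing a (u * lin f')"
proof -
  let ?r = "{(f, f') \<in> carrier (dual V) \<times> carrier (dual V). \<forall>u. pairing a (u * lin f) = pairing a (u * lin f')}"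
  have "module_congruence (dual V) ?r"
    unfolding module_congruence_def
  proof (intro conjI allI impI; (elim conjE)?)
    show "equiv (carrier (dual V)) ?r"
      by (intro equivI refl_onI symI transI) auto
    fix f f' g g' assume "(f, f') \<in> ?r" "(g, g') \<in> ?r"
    then show "(f \<oplus>\<^bsub>dual V\<^esub> g, f' \<oplus>\<^bsub>dual V\<^esub> g') \<in> ?r"
      using pr.M.add.m_closed by (simp add: lin_add distrib_left pairing_add)
  next
    fix b f f' assume "(f, f') \<in> ?r"
    then show "(b \<odot>\<^bsub>dual V\<^esub> f, b \<odot>\<^bsub>dual V\<^esub> f') \<in> ?r"
      using pr.M.smult_closed by (simp add: lin_smult mult.left_commute[of _ "const b"] pairing_smult)
  qed
  moreover have "(\<Union>f\<in>bend_forms. bend_rel V n e f) \<subseteq> ?r"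
  proof
    fix t assume t: "t \<in> (\<Union>f\<in>bend_forms. bend_rel V n e f)"
    then obtain f j where f: "f \<in> bend_forms" and
      "t = (f, \<Oplus>\<^bsub>dual V\<^esub>i\<in>{1..n} - {j}. f (e i) \<odot>\<^bsub>dual V\<^esub> x i)"
      unfolding bend_rel_def by blast
    with t pairing_bend[OF f] bend_rel_closed show "t \<in> ?r"
      by auto
  qed
  ultimately have "Q_cong V n e d w \<subseteq> ?r"
    unfolding Q_cong_def bend_cong_def by (rule module_cong_gen_least)
  with assms show ?thesis by blast
qed

text \<open>
  A class in \<open>Q\<^sub>w\<close> has no coordinates, so each class is sent to the coordinates of some representative.
  The pairing does not depend on the choice (\<open>pairing_Q_cong\<close>), and this makes the substitution
  admissible for \<open>ext_dual_exists\<close>.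
\<close>

lemma functional_exists:
  "\<exists>\<psi>\<in>carrier (dual (Q_ext_pow V n e d w)). \<forall>J\<in>S d. \<psi> (pr.N.cls (pr.N.monomial J)) = a * c J"
proof -
  define rep where "rep q = (SOME f. f \<in> carrier (dual V) \<and> proj f = q)" for q
  define L where "L q = lin (rep q)" for q
  have L_proj: "pairing a (u * L (proj f)) = pairing a (u * lin f)" if f: "f \<in> carrier (dual V)" for u f
  proof -
    have "rep (proj f) \<in> carrier (dual V) \<and> proj (rep (proj f)) = proj f"
      unfolding rep_def by (rule someI[of _ f]) (simp add: f)
    then have "(rep (proj f), f) \<in> Q_cong V n e d w"
      using f proj_eq_iff by blast
    then show ?thesis
      unfolding L_def by (rule pairing_Q_cong)
  qed
  have x_closed: "x i \<in> carrier (dual V)" if "i \<in> {1..n}" for i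
    using that by (rule pr.M.family_closed)
  have "\<exists>\<psi>\<in>carrier (dual (Q_ext_pow V n e d w)). \<forall>p\<in>forms (carrier Q) d. \<psi> (pr.N.cls p) = pairing a (poly_subst L p)"
  proof (rule pr.N.ext_dual_exists)
    show "pairing a (p + q) = pairing a p + pairing a q" "pairing a (const s * p) = s * pairing a p" for p q s
      by (rule pairing_add pairing_smult)+
    fix u q q' assume "q \<in> carrier Q"
    then obtain f where f: "f \<in> carrier (dual V)" "q = proj f"
      by (auto simp: Q_carrier)
    show "pairing a (u * L (s \<odot>\<^bsub>Q\<^esub> q)) = pairing a (u * (const s * L q))" for s
      using f L_proj[of "s \<odot>\<^bsub>dual V\<^esub> f" u] L_proj[OF f(1), of u] pr.M.smult_closed[of f s]
      by (simp add: proj_smult[symmetric] lin_smult mult.left_commute[of _ "const s"] pairing_smult)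
    assume "q' \<in> carrier Q"
    then obtain g where g: "g \<in> carrier (dual V)" "q' = proj g"
      by (auto simp: Q_carrier)
    show "pairing a (u * L (q \<oplus>\<^bsub>Q\<^esub> q')) = pairing a (u * (L q + L q'))"
      using f g L_proj[of "f \<oplus>\<^bsub>dual V\<^esub> g" u] L_proj[OF f(1), of u] L_proj[OF g(1), of u]
      by (simp add: proj_add[symmetric] lin_add distrib_left pairing_add)
  next
    fix u i assume i: "i \<in> {1..n}"
    have "pairing a (u * (L (proj (x i)) * L (proj (x i)))) = pairing a ((u * L (proj (x i))) * L (proj (x i)))"
      by (simp add: mult.assoc)
    also have "\<dots> = pairing a ((u * free_var i) * L (proj (x i)))"
      unfolding L_proj[OF x_closed[OF i]] lin_basis[OF i]
      using L_proj[OF x_closed[OF i], of "u * free_var i"] by (simp add: lin_basis[OF i] ac_simps)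
    also have "\<dots> = pairing a (u * (free_var i * free_var i))"
      unfolding L_proj[OF x_closed[OF i]] lin_basis[OF i] by (simp add: mult.assoc)
    finally show "pairing a (u * (L (proj (x i)) * L (proj (x i)))) = 0"
      by (simp add: pairing_square)
  qed
  then obtain \<psi> where \<psi>: "\<psi> \<in> carrier (dual (Q_ext_pow V n e d w))"
    and ev: "\<And>p. p \<in> forms (carrier Q) d \<Longrightarrow> \<psi> (pr.N.cls p) = pairing a (poly_subst L p)"
    by blast
  \<comment> \<open>replace the representatives of the classes of \<open>x\<^sub>j\<close> by \<open>X\<^sub>j\<close>, one factor at a time\<close>
  have prod: "pairing a (u * (\<Prod>j\<in>J. L (proj (x j)))) = pairing a (u * (\<Prod>j\<in>J. free_var j))"
    if "finite J" "J \<subseteq> {1..n}" for u J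
    using that
  proof (induction J arbitrary: u rule: finite_induct)
    case (insert j J)
    have "pairing a (u * (\<Prod>j\<in>insert j J. L (proj (x j)))) = pairing a ((u * L (proj (x j))) * (\<Prod>j\<in>J. L (proj (x j))))"
      using insert by (simp add: mult.assoc)
    also have "\<dots> = pairing a ((u * L (proj (x j))) * (\<Prod>j\<in>J. free_var j))"
      using insert.IH insert.prems by blast
    also have "\<dots> = pairing a ((u * (\<Prod>j\<in>J. free_var j)) * L (proj (x j)))"
      by (simp add: ac_simps)
    also have "\<dots> = pairing a ((u * (\<Prod>j\<in>J. free_var j)) * free_var j)"
      using insert.prems L_proj[OF x_closed, of j] lin_basis[of j] by simp
    finally show ?case
      using insert by (simp add: ac_simps)
  qed simp
  have "\<psi> (pr.N.cls (pr.N.monomial J)) = a * c J" if J: "J \<in> S d" for J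
  proof -
    have J': "J \<subseteq> {1..n}" "finite J" "card J = d"
      using subsets_of_cardD[OF J] by auto
    have "\<psi> (pr.N.cls (pr.N.monomial J)) = pairing a (1 * (\<Prod>j\<in>J. L (proj (x j))))"
      using ev[of "pr.N.monomial J"] pr.N.monomial_forms[OF J'(1,2)] J'(3)
      by (simp add: pr.N.monomial_def poly_subst_prod poly_subst_free_var)
    also have "\<dots> = pairing a (Poly_Mapping.single (mset_set J) 1)"
      using prod[OF J'(2,1), of 1] by (simp add: prod_variables)
    finally show ?thesis
      using pairing_monomial[OF J] by simp
  qed
  with \<psi> show ?thesis by blast
qed

lemma dual_map_wedge:
  assumes J: "J \<in> S d"
  shows "dual_map (dual_ext_pow V n e d) (ext_proj V n e d w) \<psi> (wedge (dual V) {1..n} x J) =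
    \<psi> (pr.N.cls (pr.N.monomial J))"
proof -
  have J': "J \<subseteq> {1..n}" "finite J" "card J = d"
    using subsets_of_cardD[OF J] by auto
  have "pr.M.monomial J \<in> forms (carrier (dual V)) d"
    using pr.M.monomial_forms[OF J'(1,2)] J'(3) by simp
  then show ?thesis
    using J' by (simp add: dual_map_def pr.M.wedge_eq pr.ext_map_cls forms_subset_polys pr.free_map_monomial)
qed

lemma canonical_iso_dual_map:
  "canonical_iso V n e d (dual_map (dual_ext_pow V n e d) (ext_proj V n e d w) \<psi>) =
     cls (wedge_sum d (\<lambda>J. \<psi> (pr.N.cls (pr.N.monomial J))))"
proof -
  have "cls (wedge_sum d (\<lambda>J. dual_map (dual_ext_pow V n e d) (ext_proj V n e d w) \<psi> (wedge (dual V) {1..n} x J))) =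
      cls (wedge_sum d (\<lambda>J. \<psi> (pr.N.cls (pr.N.monomial J))))"
    by (intro arg_cong[where f = cls] sum.cong refl) (simp only: dual_map_wedge)
  then show ?thesis
    unfolding canonical_iso_def ext_finsum_wedge .
qed

lemma inj_on_dual_map:
  "inj_on (dual_map (dual_ext_pow V n e d) (ext_proj V n e d w)) (carrier (dual (Q_ext_pow V n e d w)))"
proof (rule inj_onI)
  let ?D = "dual_map (dual_ext_pow V n e d) (ext_proj V n e d w)"
  fix \<psi> \<psi>' assume \<psi>: "\<psi> \<in> carrier (dual (Q_ext_pow V n e d w))" "\<psi>' \<in> carrier (dual (Q_ext_pow V n e d w))"
    and eq: "?D \<psi> = ?D \<psi>'"
  show "\<psi> = \<psi>'"
  proof (rule dual_eqI[where M = "Q_ext_pow V n e d w"])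
    fix X assume "X \<in> carrier (Q_ext_pow V n e d w)"
    then obtain p where p: "p \<in> forms (carrier Q) d" "X = pr.N.cls p"
      by auto
    obtain q where q: "q \<in> forms (carrier (dual V)) d" "free_map proj q = p"
      using pr.free_map_surj[OF _ p(1)] Q_carrier by blast
    have "?D \<phi> (pr.M.cls q) = \<phi> X" for \<phi>
      using q p(2) by (simp add: dual_map_def pr.ext_map_cls forms_subset_polys)
    with eq show "\<psi> X = \<psi>' X" by metis
  qed (use \<psi> in \<open>simp_all only: dual_simps\<close>)
qed

lemma image_dual_map:
  "(\<lambda>\<psi>. canonical_iso V n e d (dual_map (dual_ext_pow V n e d) (ext_proj V n e d w) \<psi>)) `
     carrier (dual (Q_ext_pow V n e d w)) = range (\<lambda>a. a \<odot>\<^bsub>ext_pow V n e d\<^esub> w)"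
  unfolding canonical_iso_dual_map smult_w
proof (intro equalityI subsetI)
  fix X assume "X \<in> (\<lambda>\<psi>. cls (wedge_sum d (\<lambda>J. \<psi> (pr.N.cls (pr.N.monomial J))))) `
      carrier (dual (Q_ext_pow V n e d w))"
  then obtain \<psi> where \<psi>: "\<psi> \<in> carrier (dual (Q_ext_pow V n e d w))"
    and X: "X = cls (wedge_sum d (\<lambda>J. \<psi> (pr.N.cls (pr.N.monomial J))))"
    by blast
  let ?y = "\<lambda>J. \<psi> (pr.N.cls (pr.N.monomial J))"
  obtain J where J: "J \<in> S d" "c J \<noteq> 0"
    using ex_nonzero_coord by blast
  obtain b where b: "c J * b = 1"
    using ex_mult_inverse[OF J(2)] by blast
  have y: "?y K = b * ?y J * c K" if K: "K \<in> S d" for K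
  proof -
    have "?y K = b * (c J * ?y K)"
      using b by (simp add: mult.assoc[symmetric] mult.commute[of b "c J"])
    also have "c J * ?y K = c K * ?y J"
      using J K by (intro incident_proportional[OF pluecker_incident functional_values_incident[OF \<psi>]]) auto
    finally show ?thesis
      by (simp add: ac_simps)
  qed
  have "X = cls (wedge_sum d (\<lambda>K. b * ?y J * c K))"
    unfolding X by (intro arg_cong[where f = cls] sum.cong refl arg_cong[where f = "\<lambda>t. const t * monomial _"] y)
  then show "X \<in> range (\<lambda>a. cls (wedge_sum d (\<lambda>J. a * c J)))"
    by (rule range_eqI[where x = "b * ?y J"])
next
  fix X assume "X \<in> range (\<lambda>a. cls (wedge_sum d (\<lambda>J. a * c J)))"
  then obtain a where X: "X = cls (wedge_sum d (\<lambda>J. a * c J))"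
    by blast
  obtain \<psi> where \<psi>: "\<psi> \<in> carrier (dual (Q_ext_pow V n e d w))"
    and val: "\<And>J. J \<in> S d \<Longrightarrow> \<psi> (pr.N.cls (pr.N.monomial J)) = a * c J"
    using functional_exists[of a] by blast
  have "X = cls (wedge_sum d (\<lambda>J. \<psi> (pr.N.cls (pr.N.monomial J))))"
    unfolding X by (intro arg_cong[where f = cls] sum.cong refl) (simp only: val)
  with \<psi> show "X \<in> (\<lambda>\<psi>. cls (wedge_sum d (\<lambda>J. \<psi> (pr.N.cls (pr.N.monomial J))))) `
      carrier (dual (Q_ext_pow V n e d w))"
    by (intro image_eqI)
qed

end

theorem proposition6p2p1:
  fixes V :: "('s::idempotent_semifield, 'v) module"
    and n d :: nat
    and e :: "nat \<Rightarrow> 'v"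
    and w :: "('v multiset \<Rightarrow>\<^sub>0 's) set set"
  assumes "semimodule V"
    and "is_basis V {1..n} e"
    and "tropical_pluecker V n e d w"
  shows "inj_on (dual_map (dual_ext_pow V n e d) (ext_proj V n e d w))
           (carrier (dual (Q_ext_pow V n e d w))) \<and>
         (\<lambda>\<psi>. canonical_iso V n e d (dual_map (dual_ext_pow V n e d) (ext_proj V n e d w) \<psi>)) `
           carrier (dual (Q_ext_pow V n e d w)) =
         range (\<lambda>a. a \<odot>\<^bsub>ext_pow V n e d\<^esub> w) \<and>
         inj (\<lambda>a. a \<odot>\<^bsub>ext_pow V n e d\<^esub> w)"
proof -
  interpret semimodule V by fact
  interpret pluecker_vector V n e d w
    using assms(2,3) by unfold_locales (auto simp: is_basis_def)
  show ?thesis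
    by (intro conjI inj_on_dual_map image_dual_map inj_smult_w)
qed

end
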